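(* Suppose the following four conditions hold for a sequence of neighborhood radii $\{r_n\}_{n\in\mathbb{N}}\subseteq\mathbb{R}_+$ (the same sequence in (ii)–(iv)). (i) (Regularity) (a) $\psi$ and $\nu$ have bounded ranges, uniformly in $n$. (b) There exist constants $L,q>0$ such that $\mathbf{E}[(f_{k,l}(Z_i; g) - f_{k,l}(Z_i; g'))^2] \leq L\, \|g-g'\|_{2,i}^q$ for all $f\in\{\psi,\nu\}$, $k,l\in[p]$, $g,g'\in\mathcal{G}$, $i\in[n]$, $n\in\mathbb{N}$. (ii) (Neighborhood stability) For all $f\in\{\psi,\nu\}$ and $k,l\in[p]$, $$\max_{i,j\in[n]} \mathbf{E}\big[(f_{k,l}(Z_i,\hat g)-f_{k,l}(Z_i,\hat g^{(-i,-j)}))^2\big]^{1/2}\ \vee\ \max_{i,j\in[n]} \mathbf{E}\big[(f_{k,l}(Z_i^*,\hat g)-f_{k,l}(Z_i^*,\hat g^{(-i,-j)}))^2\big]^{1/2} = o(n^{-1/2}).$$ (iii) (Learner consistency) With $q$ from (i), $\max_{i\in[n]}\mathbf{E}\big[\|\hat g^{(-i)}-g_0\|_{2,i}^q\big] = o\big(\bar N_n(r_n)^{-1}\big)$. (iv) (Weak dependence) $n\,\beta_n(r_n)=o(1)$. Then for every $f\in\{\psi,\nu\}$ and all $k,l\in[p]$, $$\Big|\frac1n\sum_{i=1}^n\Big(\big(f_{k,l}(Z_i,\hat g)-f_{k,l}(Z_i,g_0)\big)-\big(F_{k,l}(i,\hat g)-F_{k,l}(i,g_0)\big)\Big)\Big|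 = o_p(n^{-1/2})\quad\text{as } n\to\infty.$$
   Context: For each $n$, observations are indexed by $[n]=\{1,\dots,n\}$ and $\rho_n:[n]\times[n]\to\mathbb{R}_+$ is a semi-metric. For $S_1,S_2\subseteq[n]$, $\rho_n(S_1,S_2)=\min\{\rho_n(i,j): i\in S_1,j\in S_2\}$. For $r\geq 0$, $\mathcal{N}(i,r)=\{j\in[n]:\rho_n(i,j)\le r\}$, and $\bar N_n(r)=n^{-1}\sum_{i=1}^n|\mathcal{N}(i,r)|$. The data is a triangular array $\mathbf{Z}=\{Z_i\}_{i=1}^n$ with $Z_i\in\mathcal{Z}\subseteq\mathbb{R}^{d_z}$. $\mathcal{G}$ is a set of functions $g:\mathcal{Z}\to\mathbb{R}^{d_g}$ containing $g_0$. $\psi:\mathcal{Z}\times\mathcal{G}\to\mathbb{R}^{p\times p}$, $\nu:\mathcal{Z}\times\mathcal{G}\to\mathbb{R}^p$. For $f\in\{\psi,\nu\}$, $f_{k,l}$ denotes the $(k,l)$ entry, with the convention $\nu_{k,l}=\nu_k$ if $k=l$ and $\nu_{k,l}=0$ if $k\ne l$. For a (possibly data-dependent) $g\in\mathcal{G}$, $F_{k,l}(i,g)=\int f_{k,l}(z,g)\,dP_{Z_i}(z)$ (expectation over $Z_i$ with $g$ held fixed), and $\|g\|_{2,i}=\big(\int\|g(z)\|^2dP_{Z_i}(z)\big)^{1/2}$ (Euclidean norm, $g$ held fixed). The machine learner is a measurable map $\mathcal{Z}^n\to\mathcal{G}$; $\hat g$ denotes its output on $\mathbf{Z}$. Let $\tilde{\mathbf{Z}}=\{\tilde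 Z_i\}$ and $\mathbf{Z}^*=\{Z_i^*\}$ be copies of $\mathbf{Z}$ (same joint distribution), with $\mathbf{Z},\tilde{\mathbf{Z}},\mathbf{Z}^*$ mutually independent. For $i,j\in[n]$, $\hat g^{(-i,-j)}$ is the learner's output on the dataset obtained from $\mathbf{Z}$ by replacing $Z_k$ with $\tilde Z_k$ for every $k\in\mathcal{N}(i,r_n)\cup\mathcal{N}(j,r_n)$; $\hat g^{(-i)}:=\hat g^{(-i,-i)}$. For $\sigma$-fields $\mathcal{A},\mathcal{B}$, $\beta(\mathcal{A},\mathcal{B})=\sup\frac12\sum_{j=1}^J\sum_{k=1}^K|\mathbf{P}(A_j\cap B_k)-\mathbf{P}(A_j)\mathbf{P}(B_k)|$, supremum over all finite partitions $\{A_j\}\subseteq\mathcal{A}$, $\{B_k\}\subseteq\mathcal{B}$ of the sample space. With $\sigma(S)=\sigma(\{Z_i\}_{i\in S})$, $\beta_n(r)=\sup\{\beta(\sigma(S_1),\sigma(S_2)): S_1,S_2\subseteq[n], |S_1|=1, \rho_n(S_1,S_2)>r\}$. $a\vee b=\max\{a,b\}$. *)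

theory Defs
  imports "HOL-Probability.Probability"
begin

text \<open>Indices: the paper's [n] = {1..n} is rendered as {..<n} = {0..n-1}.\<close>

definition nbhd :: "(nat \<Rightarrow> nat \<Rightarrow> nat \<Rightarrow> real) \<Rightarrow> nat \<Rightarrow> nat \<Rightarrow> real \<Rightarrow> nat set" where
  "nbhd rho n i r = {j. j < n \<and> rho n i j \<le> r}"

definition avg_nbhd :: "(nat \<Rightarrow> nat \<Rightarrow> nat \<Rightarrow> real) \<Rightarrow> nat \<Rightarrow> real \<Rightarrow> real" where
  "avg_nbhd rho n r = (\<Sum>i<n. real (card (nbhd rho n i r))) / real n"

definition fkl :: "('z \<Rightarrow> 'g \<Rightarrow> nat \<Rightarrow> nat \<Rightarrow> real) \<Rightarrow> ('z \<Rightarrow> 'g \<Rightarrow> nat \<Rightarrow> real)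
    \<Rightarrow> bool \<Rightarrow> nat \<Rightarrow> nat \<Rightarrow> 'z \<Rightarrow> 'g \<Rightarrow> real" where
  "fkl psi nu b k l z g = (if b then psi z g k l else (if k = l then nu z g k else 0))"

definition data_vec :: "(nat \<Rightarrow> nat \<Rightarrow> 'w \<Rightarrow> 'z) \<Rightarrow> nat \<Rightarrow> 'w \<Rightarrow> nat \<Rightarrow> 'z" where
  "data_vec Z n \<omega> = (\<lambda>k\<in>{..<n}. Z n k \<omega>)"

text \<open>Data with Z_k replaced by the independent copy Zt_k for k in N(i,r) \<union> N(j,r).\<close>
definition loo_data :: "(nat \<Rightarrow> nat \<Rightarrow> nat \<Rightarrow> real) \<Rightarrow> (nat \<Rightarrow> nat \<Rightarrow> 'w \<Rightarrow> 'z) \<Rightarrow> (nat \<Rightarrow> nat \<Rightarrow> 'w \<Rightarrow> 'z)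
    \<Rightarrow> nat \<Rightarrow> real \<Rightarrow> nat \<Rightarrow> nat \<Rightarrow> 'w \<Rightarrow> nat \<Rightarrow> 'z" where
  "loo_data rho Z Zt n r i j \<omega> =
     (\<lambda>k\<in>{..<n}. if k \<in> nbhd rho n i r \<union> nbhd rho n j r then Zt n k \<omega> else Z n k \<omega>)"

definition l2sq :: "'w measure \<Rightarrow> (nat \<Rightarrow> nat \<Rightarrow> 'w \<Rightarrow> 'z::euclidean_space) \<Rightarrow> nat \<Rightarrow> nat
    \<Rightarrow> ('z \<Rightarrow> 'd::euclidean_space) \<Rightarrow> ennreal" where
  "l2sq M Z n i g = (\<integral>\<^sup>+ z. ennreal ((norm (g z))\<^sup>2) \<partial>(distr M borel (Z n i)))"

definition l2pow :: "'w measure \<Rightarrow> (nat \<Rightarrow> nat \<Rightarrow> 'w \<Rightarrow> 'z::euclidean_space) \<Rightarrow> nat \<Rightarrow> nat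
    \<Rightarrow> ('z \<Rightarrow> 'd::euclidean_space) \<Rightarrow> real \<Rightarrow> ennreal" where
  "l2pow M Z n i g q = (if l2sq M Z n i g = top then top
                          else ennreal ((enn2real (l2sq M Z n i g)) powr (q / 2)))"

definition Fint :: "'w measure \<Rightarrow> (nat \<Rightarrow> nat \<Rightarrow> 'w \<Rightarrow> 'z::euclidean_space) \<Rightarrow> nat \<Rightarrow> nat
    \<Rightarrow> ('z \<Rightarrow> 'g \<Rightarrow> real) \<Rightarrow> 'g \<Rightarrow> real" where
  "Fint M Z n i f g = (\<integral> z. f z g \<partial>(distr M borel (Z n i)))"

definition gen_sigma :: "'w measure \<Rightarrow> (nat \<Rightarrow> nat \<Rightarrow> 'w \<Rightarrow> 'z::topological_space) \<Rightarrow> nat \<Rightarrow> nat set \<Rightarrow> 'w set set" where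
  "gen_sigma M Z n S = sigma_sets (space M) (\<Union>i\<in>S. {Z n i -` B \<inter> space M | B. B \<in> sets borel})"

definition is_fin_partition :: "'w measure \<Rightarrow> 'w set set \<Rightarrow> 'w set set \<Rightarrow> bool" where
  "is_fin_partition M A P \<longleftrightarrow> P \<subseteq> A \<and> finite P \<and> disjoint P \<and> \<Union>P = space M"

definition beta_coef :: "'w measure \<Rightarrow> 'w set set \<Rightarrow> 'w set set \<Rightarrow> real" where
  "beta_coef M A B = Sup {(1/2) * (\<Sum>a\<in>PA. \<Sum>b\<in>PB. \<bar>measure M (a \<inter> b) - measure M a * measure M b\<bar>)
                          | PA PB. is_fin_partition M A PA \<and> is_fin_partition M B PB}"

definition beta_n :: "'w measure \<Rightarrow> (nat \<Rightarrow> nat \<Rightarrow> 'w \<Rightarrow> 'z::topological_space)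
    \<Rightarrow> (nat \<Rightarrow> nat \<Rightarrow> nat \<Rightarrow> real) \<Rightarrow> nat \<Rightarrow> real \<Rightarrow> real" where
  "beta_n M Z rho n r = Sup {beta_coef M (gen_sigma M Z n {i}) (gen_sigma M Z n S)
                             | i S. i < n \<and> S \<subseteq> {..<n} \<and> (\<forall>j\<in>S. rho n i j > r)}"

definition emp_dev :: "'w measure \<Rightarrow> (nat \<Rightarrow> nat \<Rightarrow> 'w \<Rightarrow> 'z::euclidean_space) \<Rightarrow> nat
    \<Rightarrow> ('z \<Rightarrow> 'g \<Rightarrow> real) \<Rightarrow> 'g \<Rightarrow> 'g \<Rightarrow> 'w \<Rightarrow> real" where
  "emp_dev M Z n f gh g0 \<omega> =
     (\<Sum>i<n. (f (Z n i \<omega>) gh - f (Z n i \<omega>) g0) - (Fint M Z n i f gh - Fint M Z n i f g0)) / real n"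

end

theory Submission
  imports Defs
begin

text \<open>The second moment of the scaled sum tends to zero. Write \<open>W i x g\<close> for the centred increment
  \<open>(f x g - f x g0) - (F i g - F i g0)\<close>. Neighbourhood stability allows replacing the learner in the
  \<open>i\<close>-th summand by its output on the data with the neighbourhood of \<open>i\<close> resampled. The square of
  the new sum is expanded into pairs. For pairs within distance \<open>r\<close>, Cauchy-Schwarz, \<open>L2\<close>-continuity
  and consistency suffice, because there are only \<open>n\<close> times the average neighbourhood size of them.
  For the other pairs both neighbourhoods are resampled: \<open>\<beta>\<close>-mixing lets one integrate out a single
  observation as if it were independent of everything outside its neighbourhood, where \<open>W\<close> has mean
  zero, and the only remainder is a product of two stability errors. The mixing coefficient controls
  finite partitions only; a coupling of arbitrary bounded functions follows by approximating
  measurable sets of a product space by finite grids.\<close>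

section \<open>Total variation\<close>

text \<open>Rates decide what is affordable. There are n^2 pairs and the second moment of the sum
  must be o(n), so a far pair may cost only o(1/n). Stability makes one replacement of the learner's
  output of L2 size o(n^(-1/2)). A remainder containing one such difference times a bounded factor
  is therefore too large, while a product of two is just small enough. This dictates the
  decomposition of far pairs: whatever contains fewer than two differences has to cancel through
  centring, up to a mixing error. Near pairs number n times \<open>avg_nbhd\<close> and each is of
  size o(1 / \<open>avg_nbhd\<close>); mixing errors add up to order n^2 \<beta> = n * o(1). The
  coefficient \<beta> concerns the data alone, whereas resampled outputs also involve the copy. The
  copy is independent of the data, so it is frozen before mixing is applied. All estimates are for a
  fixed n with numerical error parameters; limits enter only in the theorem.\<close>

lemma tv_approx_from_algebra:
  assumes alg: "algebra \<Omega> D" and P: "finite_measure P" and Q: "finite_measure Q"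
    and sP: "sets P = sigma_sets \<Omega> D" and sQ: "sets Q = sigma_sets \<Omega> D"
    and C: "C \<in> sigma_sets \<Omega> D"
  shows "\<forall>e>0. \<exists>E\<in>D. measure P ((C - E) \<union> (E - C)) < e \<and> measure Q ((C - E) \<union> (E - C)) < e"
  using C
proof (induction)
  interpret alg: algebra \<Omega> D by fact
  interpret P: finite_measure P by fact
  interpret Q: finite_measure Q by fact
  \<comment> \<open>One \<open>E\<close> has to serve both measures: a comparison of
    \<open>P\<close> and \<open>Q\<close> on \<open>E\<close> carries over to \<open>C\<close> only
    if both symmetric differences are small for the same \<open>E\<close>.\<close>
  let ?ap = "\<lambda>C e. \<exists>E\<in>D. measure P ((C - E) \<union> (E - C)) < e \<and> measure Q ((C - E) \<union> (E - C)) < e"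
  have D_sets: "E \<in> sets P" "E \<in> sets Q" if "E \<in> D" for E
    using that sP sQ by (auto)
  have tri: "?ap C (e1 + e2)"
    if ap: "?ap B e1" and "B \<in> sigma_sets \<Omega> D" "C \<in> sigma_sets \<Omega> D"
       "measure P ((C - B) \<union> (B - C)) < e2" "measure Q ((C - B) \<union> (B - C)) < e2" for B C e1 e2
  proof -
    obtain E where E: "E \<in> D" "measure P ((B - E) \<union> (E - B)) < e1" "measure Q ((B - E) \<union> (E - B)) < e1"
      using ap by blast
    have s: "B \<in> sets P" "B \<in> sets Q" "C \<in> sets P" "C \<in> sets Q" using that sP sQ by auto
    have sub: "(C - E) \<union> (E - C) \<subseteq> ((B - E) \<union> (E - B)) \<union> ((C - B) \<union> (B - C))" by auto
    have "measure P ((C - E) \<union> (E - C)) \<le> measure P (((B - E) \<union> (E - B)) \<union> ((C - B) \<union> (B - C)))"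
      by (rule P.finite_measure_mono[OF sub]) (use s D_sets[OF E(1)] in auto)
    also have "\<dots> \<le> measure P ((B - E) \<union> (E - B)) + measure P ((C - B) \<union> (B - C))"
      by (rule measure_Un_le) (use s D_sets[OF E(1)] in auto)
    finally have 1: "measure P ((C - E) \<union> (E - C)) < e1 + e2" using E(2) that(4) by linarith
    have "measure Q ((C - E) \<union> (E - C)) \<le> measure Q (((B - E) \<union> (E - B)) \<union> ((C - B) \<union> (B - C)))"
      by (rule Q.finite_measure_mono[OF sub]) (use s D_sets[OF E(1)] in auto)
    also have "\<dots> \<le> measure Q ((B - E) \<union> (E - B)) + measure Q ((C - B) \<union> (B - C))"
      by (rule measure_Un_le) (use s D_sets[OF E(1)] in auto)
    finally have 2: "measure Q ((C - E) \<union> (E - C)) < e1 + e2" using E(3) that(5) by linarith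
    show ?thesis using E(1) 1 2 by blast
  qed
  {
    case (Basic a)
    then show ?case by (auto intro!: bexI[of _ a])
  next
    case Empty
    then show ?case by (auto intro!: bexI[of _ "{}"])
  next
    case (Compl a)
    have a: "a \<subseteq> \<Omega>" by (rule sigma_sets_into_sp[OF alg.space_closed Compl(1)])
    show ?case
    proof (intro allI impI)
      fix e :: real assume "e > 0"
      then obtain E where E: "E \<in> D" "measure P ((a - E) \<union> (E - a)) < e" "measure Q ((a - E) \<union> (E - a)) < e"
        using Compl(2) by blast
      have eq: "(\<Omega> - a - (\<Omega> - E)) \<union> (\<Omega> - E - (\<Omega> - a)) = (a - E) \<union> (E - a)"
        using a alg.sets_into_space[OF E(1)] by auto
      show "?ap (\<Omega> - a) e"
        by (rule bexI[of _ "\<Omega> - E"]) (simp_all only: eq E conj_absorb simp_thms alg.compl_sets)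
    qed
  next
    case (Union a)
    have aS: "a i \<in> sigma_sets \<Omega> D" for i by (rule Union(1))
    have as: "a i \<in> sets P" "a i \<in> sets Q" for i by (simp_all only: aS sP sQ)
    have fin: "\<forall>e>0. ?ap (\<Union>i<N. a i) e" for N :: nat
    proof (induction N)
      case 0
      then show ?case by (auto intro!: bexI[of _ "{}"])
    next
      case (Suc N)
      show ?case
      proof (intro allI impI)
        fix e :: real assume "e > 0"
        then have e: "e/2 > 0" by simp
        obtain E where E: "E \<in> D" "measure P (((\<Union>i<N. a i) - E) \<union> (E - (\<Union>i<N. a i))) < e/2"
           "measure Q (((\<Union>i<N. a i) - E) \<union> (E - (\<Union>i<N. a i))) < e/2"
          using Suc e by blast
        obtain F where F: "F \<in> D" "measure P ((a N - F) \<union> (F - a N)) < e/2"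
           "measure Q ((a N - F) \<union> (F - a N)) < e/2"
          using Union(2)[of N] e by blast
        let ?U = "\<Union>i<N. a i"
        have sub: "((\<Union>i<Suc N. a i) - (E \<union> F)) \<union> ((E \<union> F) - (\<Union>i<Suc N. a i)) \<subseteq>
            ((?U - E) \<union> (E - ?U)) \<union> ((a N - F) \<union> (F - a N))" by (auto simp: less_Suc_eq)
        have U: "?U \<in> sets P" "?U \<in> sets Q" using as by auto
        have "measure P (((\<Union>i<Suc N. a i) - (E \<union> F)) \<union> ((E \<union> F) - (\<Union>i<Suc N. a i)))
           \<le> measure P (((?U - E) \<union> (E - ?U)) \<union> ((a N - F) \<union> (F - a N)))"
          by (rule P.finite_measure_mono[OF sub]) (use U as D_sets[OF E(1)] D_sets[OF F(1)] in auto)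
        also have "\<dots> \<le> measure P ((?U - E) \<union> (E - ?U)) + measure P ((a N - F) \<union> (F - a N))"
          by (rule measure_Un_le) (use U as D_sets[OF E(1)] D_sets[OF F(1)] in auto)
        finally have 1: "measure P (((\<Union>i<Suc N. a i) - (E \<union> F)) \<union> ((E \<union> F) - (\<Union>i<Suc N. a i))) < e"
          using E F by linarith
        have "measure Q (((\<Union>i<Suc N. a i) - (E \<union> F)) \<union> ((E \<union> F) - (\<Union>i<Suc N. a i)))
           \<le> measure Q (((?U - E) \<union> (E - ?U)) \<union> ((a N - F) \<union> (F - a N)))"
          by (rule Q.finite_measure_mono[OF sub]) (use U as D_sets[OF E(1)] D_sets[OF F(1)] in auto)
        also have "\<dots> \<le> measure Q ((?U - E) \<union> (E - ?U)) + measure Q ((a N - F) \<union> (F - a N))"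
          by (rule measure_Un_le) (use U as D_sets[OF E(1)] D_sets[OF F(1)] in auto)
        finally have 2: "measure Q (((\<Union>i<Suc N. a i) - (E \<union> F)) \<union> ((E \<union> F) - (\<Union>i<Suc N. a i))) < e"
          using E F by linarith
        show "?ap (\<Union>i<Suc N. a i) e"
          using 1 2 E(1) F(1) by (intro bexI[of _ "E \<union> F"]) auto
      qed
    qed
    show ?case
    proof (intro allI impI)
      fix e :: real assume "e > 0"
      then have e: "e/2 > 0" by simp
      \<comment> \<open>The first \<open>N\<close> sets miss only this tail. It decreases to the
        empty set, so some \<open>N\<close> makes it small under both measures, and
        \<open>tri\<close> adds this error to that of the finite union.\<close>
      let ?T = "\<lambda>N. (\<Union>i. a i) - (\<Union>i<N. a i)"
      have dec: "decseq ?T" by (auto simp: decseq_def)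
      have int: "(\<Inter>N. ?T N) = {}" by auto
      have "(\<lambda>N. measure P (?T N)) \<longlonglongrightarrow> measure P (\<Inter>N. ?T N)"
        by (rule P.finite_Lim_measure_decseq[OF _ dec]) (use as in auto)
      then have "\<forall>\<^sub>F N in sequentially. measure P (?T N) < e/2"
        using e unfolding int measure_empty by (rule order_tendstoD(2))
      moreover have "(\<lambda>N. measure Q (?T N)) \<longlonglongrightarrow> measure Q (\<Inter>N. ?T N)"
        by (rule Q.finite_Lim_measure_decseq[OF _ dec]) (use as in auto)
      then have "\<forall>\<^sub>F N in sequentially. measure Q (?T N) < e/2"
        using e unfolding int measure_empty by (rule order_tendstoD(2))
      ultimately have "\<forall>\<^sub>F N in sequentially. measure P (?T N) < e/2 \<and> measure Q (?T N) < e/2"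
        by eventually_elim auto
      then obtain N where N: "measure P (?T N) < e/2" "measure Q (?T N) < e/2"
        by (auto simp: eventually_sequentially)
      have eq: "?T N \<union> ((\<Union>i<N. a i) - (\<Union>i. a i)) = ?T N" by auto
      have "(\<Union>i<N. a i) \<in> sigma_sets \<Omega> D"  using as by (metis sP sets.finite_UN finite_lessThan)
      then have "?ap (\<Union>i. a i) (e/2 + e/2)"
        by (rule tri[where B="\<Union>i<N. a i", OF fin[rule_format, OF e] _ sigma_sets.Union[OF aS]])
           (use N eq in \<open>simp_all only:\<close>)
      then show "?ap (\<Union>i. a i) e" by simp
    qed
  }
qed

lemma tv_extend_from_algebra:
  assumes alg: "algebra \<Omega> D" and P: "finite_measure P" and Q: "finite_measure Q"
    and sP: "sets P = sigma_sets \<Omega> D" and sQ: "sets Q = sigma_sets \<Omega> D"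
    and le: "\<And>E. E \<in> D \<Longrightarrow> \<bar>measure P E - measure Q E\<bar> \<le> \<delta>"
    and C: "C \<in> sigma_sets \<Omega> D"
  shows "\<bar>measure P C - measure Q C\<bar> \<le> \<delta>"
proof (rule field_le_epsilon)
  interpret P: finite_measure P by fact
  interpret Q: finite_measure Q by fact
  fix e :: real assume "e > 0"
  then have "e/2 > 0" by simp
  then obtain E where E: "E \<in> D" "measure P ((C - E) \<union> (E - C)) < e/2" "measure Q ((C - E) \<union> (E - C)) < e/2"
    using tv_approx_from_algebra[OF alg P Q sP sQ C] by blast
  have s: "C \<in> sets P" "E \<in> sets P" "C \<in> sets Q" "E \<in> sets Q" using C E sP sQ by auto
  have ab: "\<bar>measure N C - measure N E\<bar> \<le> measure N ((C - E) \<union> (E - C))"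
    if "finite_measure N" "C \<in> sets N" "E \<in> sets N" for N
  proof -
    interpret N: finite_measure N by fact
    have "measure N C \<le> measure N (E \<union> ((C - E) \<union> (E - C)))"
      by (rule N.finite_measure_mono) (use that in auto)
    also have "\<dots> \<le> measure N E + measure N ((C - E) \<union> (E - C))"
      by (rule measure_Un_le) (use that in auto)
    finally have 1: "measure N C \<le> measure N E + measure N ((C - E) \<union> (E - C))" .
    have "measure N E \<le> measure N (C \<union> ((C - E) \<union> (E - C)))"
      by (rule N.finite_measure_mono) (use that in auto)
    also have "\<dots> \<le> measure N C + measure N ((C - E) \<union> (E - C))"
      by (rule measure_Un_le) (use that in auto)
    finally show ?thesis using 1 by linarith
  qed
  show "\<bar>measure P C - measure Q C\<bar> \<le> \<delta> + e"
    using ab[OF P s(1,2)] ab[OF Q s(3,4)] le[OF E(1)] E(2,3) by linarith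
qed

text \<open>The sum counts the integers from 1 up to \<open>real m * x\<close>, so it is the floor
  of \<open>real m * x\<close>. With \<open>x\<close> replaced by a function, this turns a
  [0,1]-valued function into an average of \<open>m\<close> indicators of level sets.\<close>

lemma floor_sum_indicator:
  fixes x :: real
  assumes "0 \<le> x" "x \<le> 1" "0 < m"
  shows "\<bar>x - (\<Sum>k=1..m. of_bool (real k \<le> real m * x)) / real m\<bar> \<le> 1 / real m"
proof -
  define j where "j = nat \<lfloor>real m * x\<rfloor>"
  have mx: "0 \<le> real m * x" "real m * x \<le> real m" using assms by (auto simp: mult_left_le)
  have j: "real j \<le> real m * x" "real m * x < real j + 1"
    using mx unfolding j_def by (auto simp: of_nat_nat)
  have le: "real k \<le> real m * x \<longleftrightarrow> k \<le> j" for k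
  proof
    assume "real k \<le> real m * x"
    then have "real k < real j + 1" using j by linarith
    then show "k \<le> j" by linarith
  next
    assume "k \<le> j" then have "real k \<le> real j" by simp
    then show "real k \<le> real m * x" using j by linarith
  qed
  have "j \<le> m" using j mx by linarith
  have "(\<Sum>k=1..m. of_bool (real k \<le> real m * x)) = real (card ({1..m} \<inter> {k. k \<le> j}))"
    unfolding le by (simp add: sum.If_cases of_bool_def)
  also have "{1..m} \<inter> {k. k \<le> j} = {1..j}" using \<open>j \<le> m\<close> by auto
  finally have eq: "(\<Sum>k=1..m. of_bool (real k \<le> real m * x)) = real j" by simp
  have "\<bar>real m * x - real j\<bar> / real m \<le> 1 / real m"
    using j assms by (intro divide_right_mono) auto
  moreover have "\<bar>real m * x - real j\<bar> / real m = \<bar>x - real j / real m\<bar>"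
    using assms by (simp add: abs_if field_simps)
  ultimately show ?thesis unfolding eq by simp
qed

text \<open>Averaging over level sets keeps the bound at \<delta>: each of the \<open>m\<close>
  level sets contributes at most \<delta>, and the sum is divided by \<open>m\<close>.\<close>

lemma tv_integral_unit:
  assumes P: "prob_space P" and Q: "prob_space Q" and s: "sets Q = sets P"
    and le: "\<And>C. C \<in> sets P \<Longrightarrow> \<bar>measure P C - measure Q C\<bar> \<le> \<delta>"
    and h[measurable]: "h \<in> borel_measurable P" and b: "\<And>x. x \<in> space P \<Longrightarrow> 0 \<le> h x \<and> h x \<le> (1::real)"
  shows "\<bar>(\<integral>x. h x \<partial>P) - (\<integral>x. h x \<partial>Q)\<bar> \<le> \<delta>"
proof -
  interpret P: prob_space P by fact
  interpret Q: prob_space Q by fact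
  have sp: "space Q = space P" using s by (rule sets_eq_imp_space_eq)
  have hQ[measurable]: "h \<in> borel_measurable Q" using h by (simp cong: measurable_cong_sets add: s)
  have approx: "\<bar>(\<integral>x. h x \<partial>N) - (\<Sum>k=1..m. measure N {x\<in>space N. real k \<le> real m * h x}) / real m\<bar> \<le> 1 / real m"
    if N: "prob_space N" and [measurable]: "h \<in> borel_measurable N"
      and b: "\<And>x. x \<in> space N \<Longrightarrow> 0 \<le> h x \<and> h x \<le> (1::real)" and m: "m > 0" for N and m :: nat
  proof -
    interpret N: prob_space N by fact
    have ih: "integrable N h" by (rule N.integrable_const_bound[where B=1]) (use b in auto)
    have ik: "integrable N (\<lambda>x. of_bool (real k \<le> real m * h x) :: real)" for k :: nat
      by (rule N.integrable_const_bound[where B=1]) auto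
    have ints: "integrable N (\<lambda>x. (\<Sum>k=1..m. of_bool (real k \<le> real m * h x)) / real m)"
      by (intro integrable_divide_zero Bochner_Integration.integrable_sum ik)
    have *: "(\<integral>x. of_bool (real k \<le> real m * h x) \<partial>N) = measure N {x\<in>space N. real k \<le> real m * h x}" for k :: nat
    proof -
      have "(\<integral>x. of_bool (real k \<le> real m * h x) \<partial>N) = (\<integral>x. indicator {x\<in>space N. real k \<le> real m * h x} x \<partial>N :: real)"
        by (rule Bochner_Integration.integral_cong) (auto simp: indicator_def)
      also have "\<dots> = measure N {x\<in>space N. real k \<le> real m * h x}"
        by (auto intro!: arg_cong[where f="measure N"])
      finally show ?thesis .
    qed
    have "(\<integral>x. h x \<partial>N) - (\<Sum>k=1..m. measure N {x\<in>space N. real k \<le> real m * h x}) / real m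
       = (\<integral>x. h x - (\<Sum>k=1..m. of_bool (real k \<le> real m * h x) :: real) / real m \<partial>N)"
    proof -
      have "(\<integral>x. (\<Sum>k=1..m. of_bool (real k \<le> real m * h x) :: real) / real m \<partial>N)
          = (\<Sum>k=1..m. (\<integral>x. of_bool (real k \<le> real m * h x) \<partial>N)) / real m"
        using ik by (simp only: integral_divide_zero Bochner_Integration.integral_sum)
      then show ?thesis
        unfolding Bochner_Integration.integral_diff[OF ih ints] by (simp only: *)
    qed
    also have "\<bar>\<dots>\<bar> \<le> (\<integral>x. \<bar>h x - (\<Sum>k=1..m. of_bool (real k \<le> real m * h x)) / real m\<bar> \<partial>N)"
      by (rule integral_abs_bound)
    also have "\<dots> \<le> (\<integral>x. 1 / real m \<partial>N)"
      by (intro integral_mono integrable_abs Bochner_Integration.integrable_diff ih ints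
            floor_sum_indicator) (use b m in auto)
    finally show ?thesis by (simp add: N.prob_space)
  qed
  show ?thesis
  proof (rule field_le_epsilon)
    fix e :: real assume e: "e > 0"
    \<comment> \<open>Each of the two integrals is off by at most 1/m from its level-set average,
      hence the 2.\<close>
    obtain m :: nat where m: "2 / e < real m" using reals_Archimedean2 by blast
    then have m0: "m > 0" using e by (cases m) (auto simp: field_simps)
    have m2: "2 / real m < e" using m e m0 by (simp add: field_simps)
    let ?S = "\<lambda>N. (\<Sum>k=1..m. measure N {x\<in>space P. real k \<le> real m * h x})"
    have "\<bar>?S P - ?S Q\<bar> \<le> (\<Sum>k=1..m. \<delta>)"
      unfolding sum_subtractf[symmetric]
      by (rule order_trans[OF sum_abs]) (rule sum_mono, rule le, measurable)
    then have "\<bar>?S P - ?S Q\<bar> / real m \<le> \<delta>" using m0 by (simp add: field_simps)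
    then have "\<bar>?S P / real m - ?S Q / real m\<bar> \<le> \<delta>" using m0 by (simp add: diff_divide_distrib[symmetric])
    then show "\<bar>(\<integral>x. h x \<partial>P) - (\<integral>x. h x \<partial>Q)\<bar> \<le> \<delta> + e"
      using approx[OF P h b m0] approx[OF Q hQ _ m0] b m2 unfolding sp by fastforce
  qed
qed

text \<open>The affine map (h + K) / (2 K) takes [-K, K] onto [0, 1]; undoing it costs the factor
  \<open>2 * K\<close>.\<close>

lemma tv_integral:
  fixes h :: "_ \<Rightarrow> real"
  assumes P: "prob_space P" and Q: "prob_space Q" and s: "sets Q = sets P"
    and le: "\<And>C. C \<in> sets P \<Longrightarrow> \<bar>measure P C - measure Q C\<bar> \<le> \<delta>"
    and h[measurable]: "h \<in> borel_measurable P" and b: "\<And>x. x \<in> space P \<Longrightarrow> \<bar>h x\<bar> \<le> K"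
    and K: "K > 0"
  shows "\<bar>(\<integral>x. h x \<partial>P) - (\<integral>x. h x \<partial>Q)\<bar> \<le> 2 * K * \<delta>"
proof -
  interpret P: prob_space P by fact
  interpret Q: prob_space Q by fact
  have sp: "space Q = space P" using s by (rule sets_eq_imp_space_eq)
  have hQ[measurable]: "h \<in> borel_measurable Q" using h by (simp cong: measurable_cong_sets add: s)
  have 1: "\<bar>(\<integral>x. (h x + K) / (2 * K) \<partial>P) - (\<integral>x. (h x + K) / (2 * K) \<partial>Q)\<bar> \<le> \<delta>"
    by (rule tv_integral_unit[OF P Q s le]) (use b K in \<open>auto simp: field_simps abs_le_iff\<close>, fastforce+)
  have "integrable P h" by (rule P.integrable_const_bound[where B=K]) (use b in auto)
  moreover have "integrable Q h" by (rule Q.integrable_const_bound[where B=K]) (use b sp in auto)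
  ultimately have "(\<integral>x. (h x + K) / (2 * K) \<partial>P) - (\<integral>x. (h x + K) / (2 * K) \<partial>Q) =
     ((\<integral>x. h x \<partial>P) - (\<integral>x. h x \<partial>Q)) / (2 * K)"
    by (simp add: P.prob_space Q.prob_space diff_divide_distrib add_divide_distrib)
  then show ?thesis using 1 K by (simp add: abs_divide field_simps)
qed

section \<open>Mixing coefficients and decoupling\<close>

context prob_space begin

lemma partition_measure_sum:
  assumes P: "is_fin_partition M A P" and A: "A \<subseteq> events" and a: "a \<in> events"
  shows "(\<Sum>b\<in>P. prob (a \<inter> b)) = prob a"
proof -
  have "prob (\<Union>b\<in>P. a \<inter> b) = (\<Sum>b\<in>P. prob (a \<inter> b))"
  proof (rule finite_measure_finite_Union)
    show "disjoint_family_on (\<lambda>b. a \<inter> b) P"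
      using P unfolding is_fin_partition_def disjoint_family_on_def disjoint_def by blast
  qed (use P A a in \<open>auto simp: is_fin_partition_def\<close>)
  moreover have "(\<Union>b\<in>P. a \<inter> b) = a"
    using P sets.sets_into_space[OF a] by (auto simp: is_fin_partition_def)
  ultimately show ?thesis by simp
qed

text \<open>Bounds the set whose supremum is \<open>beta_coef\<close>; a real \<open>Sup\<close> is
  only informative for sets that are bounded above. It suffices that |x - y| <= x + y for
  nonnegative x and y, as both resulting double sums equal 1.\<close>

lemma partition_dependence_le_1:
  assumes PA: "is_fin_partition M A PA" and A: "A \<subseteq> events"
    and PB: "is_fin_partition M B PB" and B: "B \<subseteq> events"
  shows "(1/2) * (\<Sum>a\<in>PA. \<Sum>b\<in>PB. \<bar>prob (a \<inter> b) - prob a * prob b\<bar>) \<le> 1"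
proof -
  have ev: "a \<in> events" if "a \<in> PA" for a using that PA A by (auto simp: is_fin_partition_def)
  have total: "(\<Sum>b\<in>P. prob b) = 1" if P: "is_fin_partition M C P" and C: "C \<subseteq> events" for C P
  proof -
    have "space M \<inter> b = b" if "b \<in> P" for b using P that by (auto simp: is_fin_partition_def)
    then show ?thesis
      using partition_measure_sum[OF P C sets.top] by (simp add: prob_space)
  qed
  note sA = total[OF PA A] and sB = total[OF PB B]
  have "(\<Sum>a\<in>PA. \<Sum>b\<in>PB. \<bar>prob (a \<inter> b) - prob a * prob b\<bar>)
     \<le> (\<Sum>a\<in>PA. \<Sum>b\<in>PB. prob (a \<inter> b) + prob a * prob b)"
    by (intro sum_mono) (smt (verit) measure_nonneg mult_nonneg_nonneg)
  also have "\<dots> = 2"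
    using partition_measure_sum[OF PB B ev] sA sB
    by (simp add: sum.distrib sum_distrib_left[symmetric])
  finally show ?thesis by simp
qed

lemma beta_coef_upper:
  assumes A: "A \<subseteq> events" and B: "B \<subseteq> events"
    and PA: "is_fin_partition M A PA" and PB: "is_fin_partition M B PB"
  shows "(\<Sum>a\<in>PA. \<Sum>b\<in>PB. \<bar>prob (a \<inter> b) - prob a * prob b\<bar>) \<le> 2 * beta_coef M A B"
proof -
  have "(1/2) * (\<Sum>a\<in>PA. \<Sum>b\<in>PB. \<bar>prob (a \<inter> b) - prob a * prob b\<bar>) \<le> beta_coef M A B"
    unfolding beta_coef_def
  proof (rule cSup_upper)
    show "bdd_above {(1/2) * (\<Sum>a\<in>PA. \<Sum>b\<in>PB. \<bar>prob (a \<inter> b) - prob a * prob b\<bar>)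
       | PA PB. is_fin_partition M A PA \<and> is_fin_partition M B PB}"
      using partition_dependence_le_1[OF _ A _ B] by (intro bdd_aboveI[of _ 1]) blast
  qed (use PA PB in blast)
  then show ?thesis by simp
qed

text \<open>Plays the same role for the outer supremum in \<open>beta_n\<close>. The trivial
  partition makes the inner set nonempty.\<close>

lemma beta_coef_le_1:
  assumes A: "A \<subseteq> events" "space M \<in> A" and B: "B \<subseteq> events" "space M \<in> B"
  shows "beta_coef M A B \<le> 1"
  unfolding beta_coef_def
proof (rule cSup_least)
  have "is_fin_partition M A {space M}" "is_fin_partition M B {space M}"
    using A B by (auto simp: is_fin_partition_def)
  then show "{(1/2) * (\<Sum>a\<in>PA. \<Sum>b\<in>PB. \<bar>prob (a \<inter> b) - prob a * prob b\<bar>)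
     | PA PB. is_fin_partition M A PA \<and> is_fin_partition M B PB} \<noteq> {}"
    by blast
qed (use partition_dependence_le_1[OF _ A(1) _ B(1)] in blast)

lemma preimage_partition:
  fixes U :: "'a \<Rightarrow> nat"
  assumes "\<And>i. U -` {i} \<inter> space M \<in> A" "\<And>\<omega>. U \<omega> < m"
  shows "is_fin_partition M A ((\<lambda>i. U -` {i} \<inter> space M) ` {..<m})"
  using assms by (auto simp: is_fin_partition_def disjoint_def)

text \<open>Two values can share a preimage only if it is empty, and an empty block contributes 0.
  So the sum over values agrees with the sum over the partition viewed as a set of blocks.\<close>

lemma discrete_dependence_le_beta:
  fixes U V :: "'a \<Rightarrow> nat"
  assumes A: "A \<subseteq> events" and B: "B \<subseteq> events"
    and U: "\<And>i. U -` {i} \<inter> space M \<in> A" "\<And>\<omega>. U \<omega> < m"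
    and V: "\<And>i. V -` {i} \<inter> space M \<in> B" "\<And>\<omega>. V \<omega> < m'"
  shows "(\<Sum>i<m. \<Sum>j<m'. \<bar>prob ((U -` {i} \<inter> space M) \<inter> (V -` {j} \<inter> space M))
      - prob (U -` {i} \<inter> space M) * prob (V -` {j} \<inter> space M)\<bar>) \<le> 2 * beta_coef M A B"
proof -
  let ?a = "\<lambda>i. U -` {i} \<inter> space M" and ?b = "\<lambda>i. V -` {i} \<inter> space M"
  have "(\<Sum>i<m. \<Sum>j<m'. \<bar>prob (?a i \<inter> ?b j) - prob (?a i) * prob (?b j)\<bar>)
    = (\<Sum>i<m. \<Sum>b\<in>?b`{..<m'}. \<bar>prob (?a i \<inter> b) - prob (?a i) * prob b\<bar>)"
  proof (rule sum.cong[OF refl])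
    fix i
    have "(\<Sum>b\<in>?b`{..<m'}. \<bar>prob (?a i \<inter> b) - prob (?a i) * prob b\<bar>) =
       sum ((\<lambda>b. \<bar>prob (?a i \<inter> b) - prob (?a i) * prob b\<bar>) \<circ> ?b) {..<m'}"
    proof (rule sum.reindex_nontrivial)
      fix x y assume "x \<noteq> y" "?b x = ?b y"
      then have "?b x = {}" by auto
      then show "\<bar>prob (?a i \<inter> ?b x) - prob (?a i) * prob (?b x)\<bar> = 0" by (simp only:) simp
    qed simp
    then show "(\<Sum>j<m'. \<bar>prob (?a i \<inter> ?b j) - prob (?a i) * prob (?b j)\<bar>) =
       (\<Sum>b\<in>?b`{..<m'}. \<bar>prob (?a i \<inter> b) - prob (?a i) * prob b\<bar>)" by (simp add: o_def)
  qed
  also have "\<dots> = (\<Sum>a\<in>?a`{..<m}. \<Sum>b\<in>?b`{..<m'}. \<bar>prob (a \<inter> b) - prob a * prob b\<bar>)"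
  proof -
    have "(\<Sum>a\<in>?a`{..<m}. \<Sum>b\<in>?b`{..<m'}. \<bar>prob (a \<inter> b) - prob a * prob b\<bar>) =
       sum ((\<lambda>a. \<Sum>b\<in>?b`{..<m'}. \<bar>prob (a \<inter> b) - prob a * prob b\<bar>) \<circ> ?a) {..<m}"
    proof (rule sum.reindex_nontrivial)
      fix x y assume "x \<noteq> y" "?a x = ?a y"
      then have "?a x = {}" by auto
      then show "(\<Sum>b\<in>?b`{..<m'}. \<bar>prob (?a x \<inter> b) - prob (?a x) * prob b\<bar>) = 0" by (simp only:) simp
    qed simp
    then show ?thesis by (simp add: o_def)
  qed
  also have "\<dots> \<le> 2 * beta_coef M A B"
    by (rule beta_coef_upper[OF A B preimage_partition preimage_partition]) (use U V in auto)
  finally show ?thesis .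
qed

end

text \<open>Sets that a pair of finitely valued functions, one per coordinate, can distinguish:
  unlike finite unions of rectangles, these are closed under unions by pairing the functions.\<close>

definition grid_sets :: "'a measure \<Rightarrow> 'b measure \<Rightarrow> ('a \<times> 'b) set set" where
  "grid_sets MX MY = {{w \<in> space (MX \<Otimes>\<^sub>M MY). R (u (fst w)) (v (snd w))} | R u v.
     u \<in> MX \<rightarrow>\<^sub>M count_space UNIV \<and> v \<in> MY \<rightarrow>\<^sub>M count_space UNIV \<and>
     (\<exists>m::nat. \<forall>x. u x < m) \<and> (\<exists>m::nat. \<forall>y. v y < m)}"

lemma grid_setsI:
  assumes "u \<in> MX \<rightarrow>\<^sub>M count_space UNIV" "v \<in> MY \<rightarrow>\<^sub>M count_space UNIV"
     "\<And>x. u x < (m::nat)" "\<And>y. v y < (m'::nat)"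
     "E = {w \<in> space (MX \<Otimes>\<^sub>M MY). R (u (fst w)) (v (snd w))}"
  shows "E \<in> grid_sets MX MY"
  using assms unfolding grid_sets_def by blast

lemma grid_setsE:
  assumes "E \<in> grid_sets MX MY"
  obtains R u v m m' where "u \<in> MX \<rightarrow>\<^sub>M count_space UNIV" "v \<in> MY \<rightarrow>\<^sub>M count_space UNIV"
     "\<And>x. u x < (m::nat)" "\<And>y. v y < (m'::nat)"
     "E = {w \<in> space (MX \<Otimes>\<^sub>M MY). R (u (fst w)) (v (snd w))}"
  using assms unfolding grid_sets_def by blast

text \<open>Any common bound will do: a sum of naturals over the finitely many possible pairs
  dominates each of its terms.\<close>

lemma bounded_prod_encode:
  fixes u v :: "'a \<Rightarrow> nat"
  assumes "\<And>x. u x < m" "\<And>x. v x < m'"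
  shows "prod_encode (u x, v x) < Suc (\<Sum>p\<in>{..<m}\<times>{..<m'}. prod_encode p)"
proof -
  have "prod_encode (u x, v x) \<le> (\<Sum>p\<in>{..<m}\<times>{..<m'}. prod_encode p)"
    by (rule member_le_sum) (use assms in auto)
  then show ?thesis by simp
qed

lemma measurable_prod_encode:
  assumes [measurable]: "u \<in> N \<rightarrow>\<^sub>M count_space UNIV" "v \<in> N \<rightarrow>\<^sub>M count_space UNIV"
  shows "(\<lambda>x. prod_encode (u x, v x)) \<in> N \<rightarrow>\<^sub>M count_space UNIV"
proof (rule measurable_compose[where f="\<lambda>x. (u x, v x)"])
  have "(\<lambda>x. (u x, v x)) \<in> N \<rightarrow>\<^sub>M count_space UNIV \<Otimes>\<^sub>M count_space UNIV" by measurable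
  then show "(\<lambda>x. (u x, v x)) \<in> N \<rightarrow>\<^sub>M count_space (UNIV \<times> UNIV)"
    by (simp add: pair_measure_countable)
qed simp

lemma algebra_grid_sets: "algebra (space (MX \<Otimes>\<^sub>M MY)) (grid_sets MX MY)"
  unfolding algebra_iff_Un
proof (intro conjI ballI)
  show "grid_sets MX MY \<subseteq> Pow (space (MX \<Otimes>\<^sub>M MY))" by (auto simp: grid_sets_def)
  show "{} \<in> grid_sets MX MY"
    by (rule grid_setsI[where u="\<lambda>_. 0" and v="\<lambda>_. 0" and m=1 and m'=1 and R="\<lambda>_ _. False"]) auto
  fix a assume a: "a \<in> grid_sets MX MY"
  then show "space (MX \<Otimes>\<^sub>M MY) - a \<in> grid_sets MX MY"
  proof (rule grid_setsE)
    fix R u v m m' assume "u \<in> MX \<rightarrow>\<^sub>M count_space UNIV" "v \<in> MY \<rightarrow>\<^sub>M count_space UNIV"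
     "\<And>x. u x < (m::nat)" "\<And>y. v y < (m'::nat)"
     "a = {w \<in> space (MX \<Otimes>\<^sub>M MY). R (u (fst w)) (v (snd w))}"
    then show ?thesis by (intro grid_setsI[where u=u and v=v and R="\<lambda>i j. \<not> R i j"]) auto
  qed
  fix b assume b: "b \<in> grid_sets MX MY"
  obtain R u v m m' where 1: "u \<in> MX \<rightarrow>\<^sub>M count_space UNIV" "v \<in> MY \<rightarrow>\<^sub>M count_space UNIV"
     "\<And>x. u x < (m::nat)" "\<And>y. v y < (m'::nat)"
     "a = {w \<in> space (MX \<Otimes>\<^sub>M MY). R (u (fst w)) (v (snd w))}" by (rule grid_setsE[OF a]) blast
  obtain R' u' v' k k' where 2: "u' \<in> MX \<rightarrow>\<^sub>M count_space UNIV" "v' \<in> MY \<rightarrow>\<^sub>M count_space UNIV"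
     "\<And>x. u' x < (k::nat)" "\<And>y. v' y < (k'::nat)"
     "b = {w \<in> space (MX \<Otimes>\<^sub>M MY). R' (u' (fst w)) (v' (snd w))}" by (rule grid_setsE[OF b]) blast
  note [measurable] = 1(1,2) 2(1,2)
  show "a \<union> b \<in> grid_sets MX MY"
  proof (rule grid_setsI)
    show "(\<lambda>x. prod_encode (u x, u' x)) \<in> MX \<rightarrow>\<^sub>M count_space UNIV"
      "(\<lambda>x. prod_encode (v x, v' x)) \<in> MY \<rightarrow>\<^sub>M count_space UNIV"
      using 1 2 by (auto intro!: measurable_prod_encode)
    show "prod_encode (u x, u' x) < Suc (\<Sum>p\<in>{..<m}\<times>{..<k}. prod_encode p)" for x
      by (rule bounded_prod_encode) (use 1 2 in auto)
    show "prod_encode (v x, v' x) < Suc (\<Sum>p\<in>{..<m'}\<times>{..<k'}. prod_encode p)" for x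
      by (rule bounded_prod_encode) (use 1 2 in auto)
    show "a \<union> b = {w \<in> space (MX \<Otimes>\<^sub>M MY).
        (\<lambda>i j. R (fst (prod_decode i)) (fst (prod_decode j)) \<or>
               R' (snd (prod_decode i)) (snd (prod_decode j)))
          (prod_encode (u (fst w), u' (fst w))) (prod_encode (v (snd w), v' (snd w)))}"
      unfolding 1(5) 2(5) by auto
  qed
qed

text \<open>A rectangle is the grid set of two indicator functions, which gives the generators of
  the product. Conversely the pair of values is coded by one natural number, and on a countable
  discrete space every relation \<open>R\<close> is measurable.\<close>

lemma sigma_sets_grid_sets:
  "sigma_sets (space (MX \<Otimes>\<^sub>M MY)) (grid_sets MX MY) = sets (MX \<Otimes>\<^sub>M MY)"
proof
  have "grid_sets MX MY \<subseteq> sets (MX \<Otimes>\<^sub>M MY)"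
  proof
    fix a assume "a \<in> grid_sets MX MY"
    then show "a \<in> sets (MX \<Otimes>\<^sub>M MY)"
    proof (rule grid_setsE)
      fix R and u v :: "_ \<Rightarrow> nat" assume [measurable]: "u \<in> MX \<rightarrow>\<^sub>M count_space UNIV" "v \<in> MY \<rightarrow>\<^sub>M count_space UNIV"
        and a: "a = {w \<in> space (MX \<Otimes>\<^sub>M MY). R (u (fst w)) (v (snd w))}"
      have "(\<lambda>w. prod_encode (u (fst w), v (snd w))) \<in> MX \<Otimes>\<^sub>M MY \<rightarrow>\<^sub>M count_space UNIV"
        by (rule measurable_prod_encode) measurable
      from measurable_compose[OF this, of "\<lambda>p. R (fst (prod_decode p)) (snd (prod_decode p))" "count_space UNIV"]
      show ?thesis unfolding a by (intro predE) simp
    qed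
  qed
  then show "sigma_sets (space (MX \<Otimes>\<^sub>M MY)) (grid_sets MX MY) \<subseteq> sets (MX \<Otimes>\<^sub>M MY)"
    by (rule sets.sigma_sets_subset)
  show "sets (MX \<Otimes>\<^sub>M MY) \<subseteq> sigma_sets (space (MX \<Otimes>\<^sub>M MY)) (grid_sets MX MY)"
    unfolding sets_pair_measure space_pair_measure
  proof (rule sigma_sets_mono, safe)
    fix a b assume ab: "a \<in> sets MX" "b \<in> sets MY"
    then have "a \<times> b \<in> grid_sets MX MY"
      using sets.sets_into_space[OF ab(1)] sets.sets_into_space[OF ab(2)]
      by (intro grid_setsI[where u="\<lambda>x. of_bool (x \<in> a)" and v="\<lambda>x. of_bool (x \<in> b)" and m=2 and m'=2
            and R="\<lambda>i j. i = 1 \<and> j = 1"]) (auto simp: of_bool_def space_pair_measure)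
    then show "a \<times> b \<in> sigma_sets (space MX \<times> space MY) (grid_sets MX MY)" by auto
  qed
qed

section \<open>Comparison of a joint law with the product of its marginals\<close>

context prob_space begin

text \<open>A grid set is a finite disjoint union of cells, and on a cell the two measures differ by
  a term of the sum that defines \<open>beta_coef\<close>. The factor 2 undoes the 1/2 in that
  definition; positive and negative cells are not separated.\<close>

lemma tv_joint_product_le_beta:
  assumes A: "A \<subseteq> events" and B: "B \<subseteq> events"
    and X: "X \<in> M \<rightarrow>\<^sub>M MX" "\<And>a. a \<in> sets MX \<Longrightarrow> X -` a \<inter> space M \<in> A"
    and Y: "Y \<in> M \<rightarrow>\<^sub>M MY" "\<And>b. b \<in> sets MY \<Longrightarrow> Y -` b \<inter> space M \<in> B"
    and C: "C \<in> sets (MX \<Otimes>\<^sub>M MY)"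
  shows "\<bar>measure (distr M (MX \<Otimes>\<^sub>M MY) (\<lambda>\<omega>. (X \<omega>, Y \<omega>))) C
      - measure (distr M MX X \<Otimes>\<^sub>M distr M MY Y) C\<bar> \<le> 2 * beta_coef M A B"
proof (rule tv_extend_from_algebra[OF algebra_grid_sets[of MX MY]])
  note [measurable] = X(1) Y(1)
  interpret DX: prob_space "distr M MX X" by (rule prob_space_distr) fact
  interpret DY: prob_space "distr M MY Y" by (rule prob_space_distr) fact
  interpret DP: pair_prob_space "distr M MX X" "distr M MY Y" ..
  interpret DJ: prob_space "distr M (MX \<Otimes>\<^sub>M MY) (\<lambda>\<omega>. (X \<omega>, Y \<omega>))"
    by (rule prob_space_distr) measurable
  show "finite_measure (distr M (MX \<Otimes>\<^sub>M MY) (\<lambda>\<omega>. (X \<omega>, Y \<omega>)))"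
    by (rule DJ.finite_measure_axioms)
  show "finite_measure (distr M MX X \<Otimes>\<^sub>M distr M MY Y)"
    by (rule DP.finite_measure_axioms)
  show "C \<in> sigma_sets (space (MX \<Otimes>\<^sub>M MY)) (grid_sets MX MY)"
    "sets (distr M (MX \<Otimes>\<^sub>M MY) (\<lambda>\<omega>. (X \<omega>, Y \<omega>))) = sigma_sets (space (MX \<Otimes>\<^sub>M MY)) (grid_sets MX MY)"
    "sets (distr M MX X \<Otimes>\<^sub>M distr M MY Y) = sigma_sets (space (MX \<Otimes>\<^sub>M MY)) (grid_sets MX MY)"
    using C by (simp_all add: sigma_sets_grid_sets cong: sets_pair_measure_cong)
  fix E assume "E \<in> grid_sets MX MY"
  then show "\<bar>measure (distr M (MX \<Otimes>\<^sub>M MY) (\<lambda>\<omega>. (X \<omega>, Y \<omega>))) E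
      - measure (distr M MX X \<Otimes>\<^sub>M distr M MY Y) E\<bar> \<le> 2 * beta_coef M A B"
  proof (rule grid_setsE)
    fix R u v m m' assume u[measurable]: "u \<in> MX \<rightarrow>\<^sub>M count_space UNIV" and v[measurable]: "v \<in> MY \<rightarrow>\<^sub>M count_space UNIV"
     and m: "\<And>x. u x < (m::nat)" "\<And>y. v y < (m'::nat)"
     and E: "E = {w \<in> space (MX \<Otimes>\<^sub>M MY). R (u (fst w)) (v (snd w))}"
    define a where "a i = u -` {i} \<inter> space MX" for i
    define b where "b j = v -` {j} \<inter> space MY" for j
    have ab[measurable]: "a i \<in> sets MX" "b i \<in> sets MY" for i unfolding a_def b_def by measurable
    define I where "I = {p \<in> {..<m} \<times> {..<m'}. R (fst p) (snd p)}"
    have E': "E = (\<Union>p\<in>I. a (fst p) \<times> b (snd p))"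
      using m by (auto simp: E I_def a_def b_def space_pair_measure)
    have fin: "finite I" unfolding I_def by auto
    have disj: "disjoint_family_on (\<lambda>p. a (fst p) \<times> b (snd p)) I"
      by (auto simp: disjoint_family_on_def a_def b_def)
    have Xa: "X -` a i \<inter> space M = (u \<circ> X) -` {i} \<inter> space M" for i
      using X(1)[THEN measurable_space] by (auto simp: a_def)
    have Yb: "Y -` b i \<inter> space M = (v \<circ> Y) -` {i} \<inter> space M" for i
      using Y(1)[THEN measurable_space] by (auto simp: b_def)
    have J: "measure (distr M (MX \<Otimes>\<^sub>M MY) (\<lambda>\<omega>. (X \<omega>, Y \<omega>))) E =
        (\<Sum>p\<in>I. prob ((X -` a (fst p) \<inter> space M) \<inter> (Y -` b (snd p) \<inter> space M)))"
      unfolding E'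
      by (subst DJ.finite_measure_finite_Union[OF fin _ disj])
         (auto simp: measure_distr intro!: sum.cong arg_cong[where f=prob])
    have Q: "measure (distr M MX X \<Otimes>\<^sub>M distr M MY Y) E =
        (\<Sum>p\<in>I. prob (X -` a (fst p) \<inter> space M) * prob (Y -` b (snd p) \<inter> space M))"
      unfolding E'
      by (subst DP.finite_measure_finite_Union[OF fin _ disj])
         (auto simp: measure_def DY.emeasure_pair_measure_Times enn2real_mult emeasure_distr
            simp del: vimage_Int intro!: sum.cong)
    let ?d = "\<lambda>i j. \<bar>prob ((X -` a i \<inter> space M) \<inter> (Y -` b j \<inter> space M))
        - prob (X -` a i \<inter> space M) * prob (Y -` b j \<inter> space M)\<bar>"
    have "\<bar>measure (distr M (MX \<Otimes>\<^sub>M MY) (\<lambda>\<omega>. (X \<omega>, Y \<omega>))) E - measure (distr M MX X \<Otimes>\<^sub>M distr M MY Y) E\<bar>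
      \<le> (\<Sum>p\<in>I. ?d (fst p) (snd p))"
      unfolding J Q sum_subtractf[symmetric] by (rule sum_abs)
    \<comment> \<open>Passing to all cells removes \<open>R\<close>, so that the bound is the same
      for every grid set.\<close>
    also have "\<dots> \<le> (\<Sum>p\<in>{..<m} \<times> {..<m'}. ?d (fst p) (snd p))"
      by (rule sum_mono2) (auto simp: I_def)
    also have "\<dots> = (\<Sum>i<m. \<Sum>j<m'. ?d i j)"
      by (simp add: sum.cartesian_product case_prod_beta)
    also have "\<dots> \<le> 2 * beta_coef M A B"
      unfolding Xa Yb
      by (rule discrete_dependence_le_beta[OF A B])
         (use m X(2)[OF ab(1)] Y(2)[OF ab(2)] in \<open>auto simp: Xa Yb\<close>)
    finally show ?thesis .
  qed
qed

text \<open>Under the product law Fubini turns the integral into the iterated one. The constant is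
  \<open>2 * K\<close> from \<open>tv_integral\<close> times 2 from
  \<open>tv_joint_product_le_beta\<close>.\<close>

lemma expectation_decouple_le_beta:
  fixes h :: "_ \<Rightarrow> real"
  assumes A: "A \<subseteq> events" and B: "B \<subseteq> events"
    and X: "X \<in> M \<rightarrow>\<^sub>M MX" "\<And>a. a \<in> sets MX \<Longrightarrow> X -` a \<inter> space M \<in> A"
    and Y: "Y \<in> M \<rightarrow>\<^sub>M MY" "\<And>b. b \<in> sets MY \<Longrightarrow> Y -` b \<inter> space M \<in> B"
    and h[measurable]: "h \<in> borel_measurable (MX \<Otimes>\<^sub>M MY)"
    and b: "\<And>x y. x \<in> space MX \<Longrightarrow> y \<in> space MY \<Longrightarrow> \<bar>h (x, y)\<bar> \<le> K" and K: "K > 0"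
  shows "\<bar>(\<integral>\<omega>. h (X \<omega>, Y \<omega>) \<partial>M) - (\<integral>\<omega>. (\<integral>x. h (x, Y \<omega>) \<partial>distr M MX X) \<partial>M)\<bar>
    \<le> 4 * K * beta_coef M A B"
proof -
  note [measurable] = X(1) Y(1)
  interpret DX: prob_space "distr M MX X" by (rule prob_space_distr) fact
  interpret DY: prob_space "distr M MY Y" by (rule prob_space_distr) fact
  interpret DP: pair_prob_space "distr M MX X" "distr M MY Y" ..
  have J: "prob_space (distr M (MX \<Otimes>\<^sub>M MY) (\<lambda>\<omega>. (X \<omega>, Y \<omega>)))" by (rule prob_space_distr) measurable
  have "\<bar>(\<integral>w. h w \<partial>distr M (MX \<Otimes>\<^sub>M MY) (\<lambda>\<omega>. (X \<omega>, Y \<omega>))) - (\<integral>w. h w \<partial>(distr M MX X \<Otimes>\<^sub>M distr M MY Y))\<bar>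
     \<le> 2 * K * (2 * beta_coef M A B)"
    by (rule tv_integral[OF J DP.prob_space_axioms])
       (use b K tv_joint_product_le_beta[OF A B X Y] in \<open>auto simp: space_pair_measure cong: sets_pair_measure_cong\<close>)
  moreover have "(\<integral>w. h w \<partial>distr M (MX \<Otimes>\<^sub>M MY) (\<lambda>\<omega>. (X \<omega>, Y \<omega>))) = (\<integral>\<omega>. h (X \<omega>, Y \<omega>) \<partial>M)"
    by (rule integral_distr) measurable
  moreover have "(\<integral>w. h w \<partial>(distr M MX X \<Otimes>\<^sub>M distr M MY Y)) = (\<integral>\<omega>. (\<integral>x. h (x, Y \<omega>) \<partial>distr M MX X) \<partial>M)"
  proof -
    have "integrable (distr M MX X \<Otimes>\<^sub>M distr M MY Y) h"
      by (rule DP.integrable_const_bound[where B=K])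
         (use b in \<open>auto simp: space_pair_measure\<close>)
    then have "(\<integral>y. (\<integral>x. h (x, y) \<partial>distr M MX X) \<partial>distr M MY Y) = (\<integral>w. h w \<partial>(distr M MX X \<Otimes>\<^sub>M distr M MY Y))"
      using DP.integral_snd[of "\<lambda>x y. h (x, y)"] by simp
    moreover have "(\<integral>y. (\<integral>x. h (x, y) \<partial>distr M MX X) \<partial>distr M MY Y) = (\<integral>\<omega>. (\<integral>x. h (x, Y \<omega>) \<partial>distr M MX X) \<partial>M)"
      by (rule integral_distr) (use Y(1) in measurable)
    ultimately show ?thesis by simp
  qed
  ultimately show ?thesis by simp
qed

end

section \<open>The learner on resampled data\<close>

lemma (in prob_space) expectation_indep_pair:
  fixes k :: "_ \<Rightarrow> real"
  assumes ind: "indep_var N1 U N2 X" and k[measurable]: "k \<in> borel_measurable (N1 \<Otimes>\<^sub>M N2)"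
    and b: "\<And>u x. u \<in> space N1 \<Longrightarrow> x \<in> space N2 \<Longrightarrow> \<bar>k (u, x)\<bar> \<le> K"
  shows "(\<integral>\<omega>. k (U \<omega>, X \<omega>) \<partial>M) = (\<integral>\<omega>. (\<integral>x. k (U \<omega>, x) \<partial>distr M N2 X) \<partial>M)"
proof -
  have U[measurable]: "U \<in> M \<rightarrow>\<^sub>M N1" and X[measurable]: "X \<in> M \<rightarrow>\<^sub>M N2"
    and J: "distr M N1 U \<Otimes>\<^sub>M distr M N2 X = distr M (N1 \<Otimes>\<^sub>M N2) (\<lambda>\<omega>. (U \<omega>, X \<omega>))"
    using ind by (auto simp: indep_var_distribution_eq)
  interpret DU: prob_space "distr M N1 U" by (rule prob_space_distr) fact
  interpret DX: prob_space "distr M N2 X" by (rule prob_space_distr) fact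
  interpret DP: pair_prob_space "distr M N1 U" "distr M N2 X" ..
  have "(\<integral>\<omega>. k (U \<omega>, X \<omega>) \<partial>M) = (\<integral>w. k w \<partial>distr M (N1 \<Otimes>\<^sub>M N2) (\<lambda>\<omega>. (U \<omega>, X \<omega>)))"
    by (rule integral_distr[symmetric]) measurable
  also have "\<dots> = (\<integral>w. k w \<partial>(distr M N1 U \<Otimes>\<^sub>M distr M N2 X))" unfolding J ..
  also have "\<dots> = (\<integral>u. (\<integral>x. k (u, x) \<partial>distr M N2 X) \<partial>distr M N1 U)"
  proof (rule DP.integral_fst'[symmetric])
    show "integrable (distr M N1 U \<Otimes>\<^sub>M distr M N2 X) k"
      by (rule DP.integrable_const_bound[where B=K]) (use b in \<open>auto simp: space_pair_measure\<close>)
  qed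
  also have "\<dots> = (\<integral>\<omega>. (\<integral>x. k (U \<omega>, x) \<partial>distr M N2 X) \<partial>M)"
    by (rule integral_distr) (use U in measurable)
  finally show ?thesis .
qed

text \<open>One sample size and one entry \<open>f\<close> are fixed. The type of learner outputs
  stays abstract, because outputs are compared only through \<open>f\<close>.\<close>

locale loo_learning = prob_space M for M :: "'w measure" +
  fixes n :: nat and Z Zt :: "nat \<Rightarrow> nat \<Rightarrow> 'w \<Rightarrow> 'z::euclidean_space"
    and rho :: "nat \<Rightarrow> nat \<Rightarrow> nat \<Rightarrow> real" and r :: real
    and G :: "'g measure" and A :: "(nat \<Rightarrow> 'z) \<Rightarrow> 'g"
    and f :: "'z \<Rightarrow> 'g \<Rightarrow> real" and C :: real and g0 :: 'g
  assumes rho_sym: "\<And>i j. rho n i j = rho n j i"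
    and Z_meas[measurable]: "\<And>i. Z n i \<in> borel_measurable M"
    and indep_copy: "indep_var (PiM {..<n} (\<lambda>_. borel)) (data_vec Zt n)
                               (PiM {..<n} (\<lambda>_. borel)) (data_vec Z n)"
    and A_meas[measurable]: "A \<in> PiM {..<n} (\<lambda>_. borel) \<rightarrow>\<^sub>M G"
    and f_meas[measurable]: "(\<lambda>(z, g). f z g) \<in> borel_measurable (borel \<Otimes>\<^sub>M G)"
    and f_bound: "\<And>z g. g \<in> space G \<Longrightarrow> \<bar>f z g\<bar> \<le> C"
    and C_pos: "C > 0"
    and g0_in[simp]: "g0 \<in> space G"
begin

abbreviation V :: "(nat \<Rightarrow> 'z) measure" where "V \<equiv> PiM {..<n} (\<lambda>_. borel)"
abbreviation P :: "nat \<Rightarrow> 'z measure" where "P i \<equiv> distr M borel (Z n i)"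
abbreviation N :: "nat \<Rightarrow> nat set" where "N i \<equiv> nbhd rho n i r"
abbreviation \<beta> :: real where "\<beta> \<equiv> beta_n M Z rho n r"

definition loo :: "nat \<Rightarrow> nat \<Rightarrow> (nat \<Rightarrow> 'z) \<times> (nat \<Rightarrow> 'z) \<Rightarrow> nat \<Rightarrow> 'z" where
  "loo i j w = (\<lambda>k\<in>{..<n}. if k \<in> N i \<union> N j then snd w k else fst w k)"

definition dat :: "'w \<Rightarrow> (nat \<Rightarrow> 'z) \<times> (nat \<Rightarrow> 'z)" where
  "dat \<omega> = (data_vec Z n \<omega>, data_vec Zt n \<omega>)"

text \<open>Deleting the neighbourhood of \<open>i\<close> by writing 0 keeps the vector in
  \<open>V\<close>, yet makes it measurable with respect to the observations outside
  \<open>N i\<close>. Resampling at \<open>i\<close> overwrites exactly these entries, so it cannot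
  notice the mask (\<open>loo_mask\<close>).\<close>

definition mask :: "nat \<Rightarrow> (nat \<Rightarrow> 'z) \<Rightarrow> nat \<Rightarrow> 'z" where
  "mask i z = (\<lambda>k\<in>{..<n}. if k \<in> N i then 0 else z k)"

definition F :: "nat \<Rightarrow> 'g \<Rightarrow> real" where
  "F i g = (\<integral>x. f x g \<partial>P i)"

definition W :: "nat \<Rightarrow> 'z \<Rightarrow> 'g \<Rightarrow> real" where
  "W i x g = (f x g - f x g0) - (F i g - F i g0)"

abbreviation \<Gamma> :: "nat \<Rightarrow> nat \<Rightarrow> (nat \<Rightarrow> 'z) \<times> (nat \<Rightarrow> 'z) \<Rightarrow> 'g" where
  "\<Gamma> i j w \<equiv> A (loo i j w)"

lemma loo_data_eq: "loo_data rho Z Zt n r i j \<omega> = loo i j (dat \<omega>)"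
  by (auto simp: loo_data_def loo_def dat_def data_vec_def fun_eq_iff restrict_def)

lemma loo_mask: "loo i j (mask i z, t) = loo i j (z, t)" "loo j i (mask i z, t) = loo j i (z, t)"
  by (auto simp: loo_def mask_def fun_eq_iff restrict_def)

lemma mask_other: "j < n \<Longrightarrow> j \<notin> N i \<Longrightarrow> mask i z j = z j"
  by (auto simp: mask_def)

lemma prob_space_P: "prob_space (P i)"
  by (rule prob_space_distr) measurable

lemma measure_P_UNIV[simp]: "measure (P i) UNIV = 1"
  using prob_space.prob_space[OF prob_space_P[of i]] by simp

lemma data_vec_meas[measurable]: "data_vec Z n \<in> M \<rightarrow>\<^sub>M V" "data_vec Zt n \<in> M \<rightarrow>\<^sub>M V"
  using indep_copy by (auto simp: indep_var_distribution_eq)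

lemma dat_meas[measurable]: "dat \<in> M \<rightarrow>\<^sub>M V \<Otimes>\<^sub>M V"
  unfolding dat_def[abs_def] by measurable

lemma loo_meas[measurable]: "loo i j \<in> V \<Otimes>\<^sub>M V \<rightarrow>\<^sub>M V"
  unfolding loo_def[abs_def] by measurable

lemma mask_meas[measurable]: "mask i \<in> V \<rightarrow>\<^sub>M V"
  unfolding mask_def[abs_def] by measurable

lemma f_meas'[measurable (raw)]:
  "u \<in> L \<rightarrow>\<^sub>M borel \<Longrightarrow> v \<in> L \<rightarrow>\<^sub>M G \<Longrightarrow> (\<lambda>x. f (u x) (v x)) \<in> borel_measurable L"
  using measurable_compose[OF measurable_Pair f_meas] by simp

lemma F_meas[measurable]: "F i \<in> borel_measurable G"
proof -
  interpret Pi: prob_space "P i" by (rule prob_space_P)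
  show ?thesis unfolding F_def[abs_def] by measurable
qed

lemma W_meas[measurable (raw)]:
  "u \<in> L \<rightarrow>\<^sub>M borel \<Longrightarrow> v \<in> L \<rightarrow>\<^sub>M G \<Longrightarrow> (\<lambda>x. W i (u x) (v x)) \<in> borel_measurable L"
  unfolding W_def
  by (intro borel_measurable_diff f_meas' borel_measurable_const measurable_compose[OF _ F_meas])
     simp_all

lemma f_integrable: "g \<in> space G \<Longrightarrow> integrable (P i) (\<lambda>x. f x g)"
proof -
  interpret Pi: prob_space "P i" by (rule prob_space_P)
  show "g \<in> space G \<Longrightarrow> integrable (P i) (\<lambda>x. f x g)"
    by (rule Pi.integrable_const_bound[where B=C]) (use f_bound in auto)
qed

lemma F_bound: "g \<in> space G \<Longrightarrow> \<bar>F i g\<bar> \<le> C"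
proof -
  assume g: "g \<in> space G"
  interpret Pi: prob_space "P i" by (rule prob_space_P)
  have "\<bar>F i g\<bar> \<le> (\<integral>x. \<bar>f x g\<bar> \<partial>P i)" unfolding F_def by (rule integral_abs_bound)
  also have "\<dots> \<le> (\<integral>x. C \<partial>P i)"
    by (rule integral_mono) (use f_integrable[OF g] f_bound[OF g] in auto)
  finally show ?thesis by (simp add: Pi.prob_space)
qed

lemma W_bound: "g \<in> space G \<Longrightarrow> \<bar>W i x g\<bar> \<le> 4 * C"
  using F_bound[of g i] F_bound[of g0 i] f_bound[of g x] f_bound[of g0 x] unfolding W_def by simp

lemma W_integrable: "g \<in> space G \<Longrightarrow> integrable (P i) (\<lambda>x. W i x g)"
  using f_integrable f_integrable[of g0] prob_space_P[of i]
  unfolding W_def by (auto intro!: Bochner_Integration.integrable_diff finite_measure.integrable_const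
     simp: prob_space_def)

lemma W_mean: "g \<in> space G \<Longrightarrow> (\<integral>x. W i x g \<partial>P i) = 0"
proof -
  assume g: "g \<in> space G"
  interpret Pi: prob_space "P i" by (rule prob_space_P)
  show ?thesis
    using f_integrable[OF g, of i] f_integrable[OF g0_in, of i] unfolding W_def
    by (simp add: F_def Pi.prob_space)
qed

lemma Gamma_in: "w \<in> space (V \<Otimes>\<^sub>M V) \<Longrightarrow> \<Gamma> i j w \<in> space G"
  using measurable_space[OF measurable_compose[OF loo_meas A_meas]] by auto

lemma dat_in: "\<omega> \<in> space M \<Longrightarrow> dat \<omega> \<in> space (V \<Otimes>\<^sub>M V)"
  by (rule measurable_space[OF dat_meas])

lemma A_in: "z \<in> space V \<Longrightarrow> A z \<in> space G"
  by (rule measurable_space[OF A_meas])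

lemma gen_sigma_events: "gen_sigma M Z n S \<subseteq> events"
  unfolding gen_sigma_def by (rule sets.sigma_sets_subset) (auto intro: measurable_sets)

lemma gen_sigma_space: "space M \<in> gen_sigma M Z n S"
  unfolding gen_sigma_def by (rule sigma_sets_top)

lemma beta_coef_le_beta_n:
  assumes "i < n" "S \<subseteq> {..<n}" "\<And>j. j \<in> S \<Longrightarrow> rho n i j > r"
  shows "beta_coef M (gen_sigma M Z n {i}) (gen_sigma M Z n S) \<le> \<beta>"
  unfolding beta_n_def
proof (rule cSup_upper)
  show "bdd_above {beta_coef M (gen_sigma M Z n {i}) (gen_sigma M Z n S) |i S.
     i < n \<and> S \<subseteq> {..<n} \<and> (\<forall>j\<in>S. r < rho n i j)}"
    by (rule bdd_aboveI[of _ 1])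
       (use beta_coef_le_1[OF gen_sigma_events gen_sigma_space gen_sigma_events gen_sigma_space] in blast)
qed (use assms in blast)

text \<open>Over the sub-sigma-algebra generated by the observations outside \<open>N i\<close>,
  each coordinate is measurable: it is either such an observation or the constant 0.\<close>

lemma mask_preimage:
  assumes "b \<in> sets V" 
  shows "(\<lambda>\<omega>. mask i (data_vec Z n \<omega>)) -` b \<inter> space M \<in> gen_sigma M Z n ({..<n} - N i)"
proof -
  let ?S = "{..<n} - N i"
  let ?M = "sigma (space M) (\<Union>i\<in>?S. {Z n i -` B \<inter> space M | B. B \<in> sets borel})"
  have sub: "(\<Union>i\<in>?S. {Z n i -` B \<inter> space M | B. B \<in> sets borel}) \<subseteq> Pow (space M)" by auto
  have sp: "space ?M = space M" using sub by (rule space_measure_of)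
  have se: "sets ?M = gen_sigma M Z n ?S" unfolding gen_sigma_def using sub by (rule sets_measure_of)
  have Zm: "Z n k \<in> ?M \<rightarrow>\<^sub>M borel" if "k \<in> ?S" for k
    unfolding measurable_def sp se using that
    by (auto simp: gen_sigma_def intro!: sigma_sets.Basic)
  have "(\<lambda>\<omega>. mask i (data_vec Z n \<omega>)) \<in> ?M \<rightarrow>\<^sub>M V"
    unfolding mask_def data_vec_def
  proof (rule measurable_restrict)
    fix k assume k: "k \<in> {..<n}"
    show "(\<lambda>\<omega>. if k \<in> N i then 0 else (\<lambda>k\<in>{..<n}. Z n k \<omega>) k) \<in> ?M \<rightarrow>\<^sub>M borel"
      using k Zm[of k] by (cases "k \<in> N i") auto
  qed
  from measurable_sets[OF this assms] show ?thesis unfolding sp se .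
qed

text \<open>By \<open>inv\<close>, \<open>h\<close> sees the data near \<open>i\<close> only through
  its first argument. For a frozen copy it is thus a function of \<open>Z n i\<close> and of
  observations farther than \<open>r\<close> from \<open>i\<close>, to which the coupling bound
  applies; averaging over the copy preserves the bound.\<close>

lemma expectation_decouple:
  fixes h :: "_ \<Rightarrow> real"
  assumes i: "i < n" and h[measurable]: "h \<in> borel_measurable (borel \<Otimes>\<^sub>M (V \<Otimes>\<^sub>M V))"
    and b: "\<And>x w. w \<in> space (V \<Otimes>\<^sub>M V) \<Longrightarrow> \<bar>h (x, w)\<bar> \<le> K" and K: "K > 0"
    and inv: "\<And>x z t. h (x, (mask i z, t)) = h (x, (z, t))"
  shows "\<bar>(\<integral>\<omega>. h (Z n i \<omega>, dat \<omega>) \<partial>M) - (\<integral>\<omega>. (\<integral>x. h (x, dat \<omega>) \<partial>P i) \<partial>M)\<bar> \<le> 4 * K * \<beta>"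
proof -
  interpret Pi: prob_space "P i" by (rule prob_space_P)
  interpret DZ: prob_space "distr M V (data_vec Z n)" by (rule prob_space_distr) measurable
  \<comment> \<open>The copy comes first, as in \<open>indep_copy\<close>, so that
    \<open>expectation_indep_pair\<close> integrates the data with the copy held fixed.\<close>
  let ?u1 = "\<lambda>(t, z). h (z i, (z, t))" and ?u2 = "\<lambda>(t, z). (\<integral>x. h (x, (z, t)) \<partial>P i)"
  have [measurable]: "(\<lambda>z. z i) \<in> V \<rightarrow>\<^sub>M borel"
    by (rule measurable_component_singleton) (use i in simp)
  have u1m[measurable]: "?u1 \<in> borel_measurable (V \<Otimes>\<^sub>M V)"
    unfolding case_prod_beta
    by (intro measurable_compose[OF _ h] measurable_Pair measurable_fst measurable_snd
          measurable_compose[OF measurable_snd \<open>(\<lambda>z. z i) \<in> V \<rightarrow>\<^sub>M borel\<close>])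
  have u2m[measurable]: "?u2 \<in> borel_measurable (V \<Otimes>\<^sub>M V)" by measurable
  have b2: "\<bar>\<integral>x. h (x, w) \<partial>P i\<bar> \<le> K" if w: "w \<in> space (V \<Otimes>\<^sub>M V)" for w
  proof -
    have [measurable]: "(\<lambda>x. h (x, w)) \<in> borel_measurable borel"
      using w by measurable
    have "integrable (P i) (\<lambda>x. h (x, w))"
      by (rule Pi.integrable_const_bound[where B=K]) (use b[OF w] in auto)
    then have "\<bar>\<integral>x. h (x, w) \<partial>P i\<bar> \<le> (\<integral>x. K \<partial>P i)"
      using b[OF w] by (intro order_trans[OF integral_abs_bound] integral_mono) auto
    then show ?thesis by (simp add: Pi.prob_space)
  qed
  have Zi: "data_vec Z n \<omega> i = Z n i \<omega>" for \<omega> using i by (simp add: data_vec_def)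
  have E1: "(\<integral>\<omega>. h (Z n i \<omega>, dat \<omega>) \<partial>M) =
      (\<integral>\<omega>'. (\<integral>\<omega>. h (Z n i \<omega>, (data_vec Z n \<omega>, data_vec Zt n \<omega>')) \<partial>M) \<partial>M)"
  proof -
    have "(\<integral>\<omega>. ?u1 (data_vec Zt n \<omega>, data_vec Z n \<omega>) \<partial>M) =
      (\<integral>\<omega>. (\<integral>z. ?u1 (data_vec Zt n \<omega>, z) \<partial>distr M V (data_vec Z n)) \<partial>M)"
      by (rule expectation_indep_pair[OF indep_copy u1m, where K=K])
         (use b in \<open>auto simp: space_pair_measure\<close>)
    also have "\<dots> = (\<integral>\<omega>'. (\<integral>\<omega>. ?u1 (data_vec Zt n \<omega>', data_vec Z n \<omega>) \<partial>M) \<partial>M)"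
      using measurable_space[OF data_vec_meas(2)] i
      by (intro Bochner_Integration.integral_cong refl integral_distr) (auto intro!: measurable_compose[OF _ h])
    finally show ?thesis by (simp add: dat_def Zi)
  qed
  have E2: "(\<integral>\<omega>. (\<integral>x. h (x, dat \<omega>) \<partial>P i) \<partial>M) =
      (\<integral>\<omega>'. (\<integral>\<omega>. (\<integral>x. h (x, (data_vec Z n \<omega>, data_vec Zt n \<omega>')) \<partial>P i) \<partial>M) \<partial>M)"
  proof -
    have "(\<integral>\<omega>. ?u2 (data_vec Zt n \<omega>, data_vec Z n \<omega>) \<partial>M) =
      (\<integral>\<omega>. (\<integral>z. ?u2 (data_vec Zt n \<omega>, z) \<partial>distr M V (data_vec Z n)) \<partial>M)"
      by (rule expectation_indep_pair[OF indep_copy u2m, where K=K])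
         (use b2 in \<open>auto simp: space_pair_measure\<close>)
    also have "\<dots> = (\<integral>\<omega>'. (\<integral>\<omega>. ?u2 (data_vec Zt n \<omega>', data_vec Z n \<omega>) \<partial>M) \<partial>M)"
      using measurable_space[OF data_vec_meas(2)]
      by (intro Bochner_Integration.integral_cong refl integral_distr) (auto intro!: measurable_compose[OF _ u2m])
    finally show ?thesis by (simp add: dat_def)
  qed
  let ?g1 = "\<lambda>\<omega>'. (\<integral>\<omega>. h (Z n i \<omega>, (data_vec Z n \<omega>, data_vec Zt n \<omega>')) \<partial>M)"
  let ?g2 = "\<lambda>\<omega>'. (\<integral>\<omega>. (\<integral>x. h (x, (data_vec Z n \<omega>, data_vec Zt n \<omega>')) \<partial>P i) \<partial>M)"
  have int: "integrable M ?g1" "integrable M ?g2"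
  proof -
    have sp: "(data_vec Z n \<omega>, data_vec Zt n \<omega>') \<in> space (V \<Otimes>\<^sub>M V)" if "\<omega> \<in> space M" "\<omega>' \<in> space M" for \<omega> \<omega>'
      using that measurable_space[OF data_vec_meas(1)] measurable_space[OF data_vec_meas(2)]
      by (auto simp: space_pair_measure)
    have bd: "\<bar>\<integral>\<omega>. q \<omega> \<partial>M\<bar> \<le> K" if "q \<in> borel_measurable M" "\<And>\<omega>. \<omega> \<in> space M \<Longrightarrow> \<bar>q \<omega>\<bar> \<le> K" for q
    proof -
      have "integrable M q" by (rule integrable_const_bound[where B=K]) (use that in auto)
      then have "\<bar>\<integral>\<omega>. q \<omega> \<partial>M\<bar> \<le> (\<integral>\<omega>. K \<partial>M)"
        using that by (intro order_trans[OF integral_abs_bound] integral_mono) auto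
      then show ?thesis by (simp add: prob_space)
    qed
    show "integrable M ?g1"
    proof (rule integrable_const_bound[where B=K])
      show "?g1 \<in> borel_measurable M" by measurable
      show "AE \<omega>' in M. norm (?g1 \<omega>') \<le> K"
      proof (rule AE_I2)
        fix \<omega>' assume w': "\<omega>' \<in> space M"
        then have [simp]: "data_vec Zt n \<omega>' \<in> space V" by (rule measurable_space[OF data_vec_meas(2)])
        show "norm (?g1 \<omega>') \<le> K" unfolding real_norm_def
          by (rule bd) (use b sp w' in auto)
      qed
    qed
    show "integrable M ?g2"
    proof (rule integrable_const_bound[where B=K])
      show "?g2 \<in> borel_measurable M" by measurable
      show "AE \<omega>' in M. norm (?g2 \<omega>') \<le> K"
      proof (rule AE_I2)
        fix \<omega>' assume w': "\<omega>' \<in> space M"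
        then have [simp]: "data_vec Zt n \<omega>' \<in> space V" by (rule measurable_space[OF data_vec_meas(2)])
        show "norm (?g2 \<omega>') \<le> K" unfolding real_norm_def
          by (rule bd) (use b2 sp w' in auto)
      qed
    qed
  qed
  have pt: "\<bar>?g1 \<omega>' - ?g2 \<omega>'\<bar> \<le> 4 * K * \<beta>" if w': "\<omega>' \<in> space M" for \<omega>'
  proof -
    define t where "t = data_vec Zt n \<omega>'"
    have t[simp]: "t \<in> space V" unfolding t_def using w' by (rule measurable_space[OF data_vec_meas(2)])
    let ?S = "{..<n} - N i"
    let ?h = "\<lambda>(x, z). h (x, (z, t))"
    have "\<bar>(\<integral>\<omega>. ?h (Z n i \<omega>, mask i (data_vec Z n \<omega>)) \<partial>M) - (\<integral>\<omega>. (\<integral>x. ?h (x, mask i (data_vec Z n \<omega>)) \<partial>P i) \<partial>M)\<bar>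
       \<le> 4 * K * beta_coef M (gen_sigma M Z n {i}) (gen_sigma M Z n ?S)"
    proof (rule expectation_decouple_le_beta[OF gen_sigma_events gen_sigma_events, where MX=borel and MY=V])
      show "Z n i -` a \<inter> space M \<in> gen_sigma M Z n {i}" if "a \<in> sets borel" for a
        using that by (auto simp: gen_sigma_def intro!: sigma_sets.Basic)
      show "?h \<in> borel_measurable (borel \<Otimes>\<^sub>M V)" by measurable
    qed (use mask_preimage b K in \<open>auto simp: space_pair_measure\<close>)
    also have "\<dots> \<le> 4 * K * \<beta>"
      using K by (intro mult_left_mono beta_coef_le_beta_n[OF i]) (auto simp: nbhd_def)
    finally show ?thesis unfolding t_def by (simp add: inv)
  qed
  have "\<bar>(\<integral>\<omega>'. ?g1 \<omega>' \<partial>M) - (\<integral>\<omega>'. ?g2 \<omega>' \<partial>M)\<bar> = \<bar>\<integral>\<omega>'. ?g1 \<omega>' - ?g2 \<omega>' \<partial>M\<bar>"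
    using int by simp
  also have "\<dots> \<le> (\<integral>\<omega>'. \<bar>?g1 \<omega>' - ?g2 \<omega>'\<bar> \<partial>M)" by (rule integral_abs_bound)
  also have "\<dots> \<le> (\<integral>\<omega>'. 4 * K * \<beta> \<partial>M)"
    by (rule integral_mono) (use int pt in auto)
  finally show ?thesis unfolding E1 E2 by (simp add: prob_space)
qed

end

section \<open>Second moments\<close>

lemma add_sq_le: "(a + b)\<^sup>2 \<le> 2 * a\<^sup>2 + 2 * (b::real)\<^sup>2"
  using zero_le_power2[of "a - b"] by (simp add: power2_eq_square algebra_simps)

lemma diff_sq_le: "(a - b)\<^sup>2 \<le> 2 * a\<^sup>2 + 2 * (b::real)\<^sup>2"
  using zero_le_power2[of "a + b"] by (simp add: power2_eq_square algebra_simps)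

lemma mult_bound: "\<bar>a\<bar> \<le> k \<Longrightarrow> \<bar>b\<bar> \<le> l \<Longrightarrow> \<bar>a * b\<bar> \<le> k * (l::real)"
  by (simp add: abs_mult mult_mono')

context loo_learning begin

lemma integrable_bounded:
  "q \<in> borel_measurable M \<Longrightarrow> (\<And>\<omega>. \<omega> \<in> space M \<Longrightarrow> \<bar>q \<omega>\<bar> \<le> (K::real)) \<Longrightarrow> integrable M q"
  by (rule integrable_const_bound[where B=K]) auto

lemma f_diff_sq_bound:
  assumes "g \<in> space G" "g' \<in> space G"
  shows "\<bar>(f x g - f x g')\<^sup>2\<bar> \<le> 4 * C\<^sup>2"
proof -
  have "\<bar>f x g - f x g'\<bar> \<le> 2 * C" using f_bound[OF assms(1), of x] f_bound[OF assms(2), of x] by linarith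
  then have "\<bar>f x g - f x g'\<bar>\<^sup>2 \<le> (2 * C)\<^sup>2" by (rule power_mono) simp
  then show ?thesis by (simp add: power_mult_distrib)
qed

lemma f_section_meas[measurable]: "g \<in> space G \<Longrightarrow> (\<lambda>x. f x g) \<in> borel_measurable borel"
  by (rule f_meas') simp_all

lemma f_diff_sq_integrable:
  assumes g: "g \<in> space G" "g' \<in> space G"
  shows "integrable (P i) (\<lambda>x. (f x g - f x g')\<^sup>2)"
proof -
  interpret Pi: prob_space "P i" by (rule prob_space_P)
  note [measurable] = g
  show ?thesis
    by (rule Pi.integrable_const_bound[where B="4 * C\<^sup>2"]) (use f_diff_sq_bound[OF g] in auto)
qed

text \<open>Mean squared distance at a fresh observation, the outputs being held fixed. It links
  three hypotheses: it is the left side of the continuity condition (\<open>f_dist_eq\<close>), its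
  expectation is the stability error at the independent copy
  (\<open>expectation_f_dist_copy\<close>), and consistency bounds it for
  \<open>g' = g0\<close>.\<close>

definition f_dist :: "nat \<Rightarrow> 'g \<Rightarrow> 'g \<Rightarrow> real" where
  "f_dist i g g' = (\<integral>x. (f x g - f x g')\<^sup>2 \<partial>P i)"

lemma f_dist_meas[measurable (raw)]:
  assumes [measurable]: "u \<in> L \<rightarrow>\<^sub>M G" "v \<in> L \<rightarrow>\<^sub>M G"
  shows "(\<lambda>x. f_dist i (u x) (v x)) \<in> borel_measurable L"
proof -
  interpret Pi: prob_space "P i" by (rule prob_space_P)
  show ?thesis unfolding f_dist_def by measurable
qed

lemma f_dist_bound:
  assumes g: "g \<in> space G" "g' \<in> space G"
  shows "0 \<le> f_dist i g g'" "f_dist i g g' \<le> 4 * C\<^sup>2"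
proof -
  interpret Pi: prob_space "P i" by (rule prob_space_P)
  show "0 \<le> f_dist i g g'" unfolding f_dist_def by (rule integral_nonneg_AE) auto
  have "f_dist i g g' \<le> (\<integral>x. 4 * C\<^sup>2 \<partial>P i)" unfolding f_dist_def
    by (rule integral_mono) (use f_diff_sq_integrable[OF g] f_diff_sq_bound[OF g] in auto)
  then show "f_dist i g g' \<le> 4 * C\<^sup>2" by (simp add: Pi.prob_space)
qed

lemma F_diff_sq_le:
  assumes g: "g \<in> space G" "g' \<in> space G"
  shows "(F i g - F i g')\<^sup>2 \<le> f_dist i g g'"
proof -
  interpret Pi: prob_space "P i" by (rule prob_space_P)
  have i: "integrable (P i) (\<lambda>x. f x g - f x g')" using f_integrable g by auto
  have "Pi.variance (\<lambda>x. f x g - f x g') = f_dist i g g' - (F i g - F i g')\<^sup>2"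
    using Pi.variance_eq[OF i f_diff_sq_integrable[OF g]] f_integrable[OF g(1), of i] f_integrable[OF g(2), of i]
    by (simp add: f_dist_def F_def)
  moreover have "Pi.variance (\<lambda>x. f x g - f x g') \<ge> 0" by (rule Pi.variance_positive)
  ultimately show ?thesis by simp
qed

text \<open>This is where the two forms of stability meet: the change of \<open>f\<close> at the
  observation itself, and the change of its mean \<open>F\<close>, whose square is at most
  \<open>f_dist\<close> because a variance is nonnegative.\<close>

lemma W_diff_sq_le:
  assumes g: "g \<in> space G" "g' \<in> space G"
  shows "(W i x g - W i x g')\<^sup>2 \<le> 2 * (f x g - f x g')\<^sup>2 + 2 * f_dist i g g'"
proof -
  have "W i x g - W i x g' = (f x g - f x g') - (F i g - F i g')" by (simp add: W_def)
  then show ?thesis using diff_sq_le[of "f x g - f x g'" "F i g - F i g'"] F_diff_sq_le[OF g, of i] by simp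
qed

lemma W_g0: "W i x g0 = 0" by (simp add: W_def)

lemma W_sq_mean_le:
  assumes g: "g \<in> space G"
  shows "(\<integral>x. (W i x g)\<^sup>2 \<partial>P i) \<le> 4 * f_dist i g g0"
proof -
  interpret Pi: prob_space "P i" by (rule prob_space_P)
  have "(\<integral>x. (W i x g)\<^sup>2 \<partial>P i) \<le> (\<integral>x. 2 * (f x g - f x g0)\<^sup>2 + 2 * f_dist i g g0 \<partial>P i)"
  proof (rule integral_mono)
    show "(W i x g)\<^sup>2 \<le> 2 * (f x g - f x g0)\<^sup>2 + 2 * f_dist i g g0" for x
      using W_diff_sq_le[OF g g0_in, of i x] by (simp add: W_g0)
    show "integrable (P i) (\<lambda>x. (W i x g)\<^sup>2)"
    proof (rule Pi.integrable_const_bound[where B="(4*C)\<^sup>2"])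
      show "AE x in P i. norm ((W i x g)\<^sup>2) \<le> (4*C)\<^sup>2"
        using W_bound[OF g, of i] power_mono[OF W_bound[OF g, of i], of _ 2] by auto
      show "(\<lambda>x. (W i x g)\<^sup>2) \<in> borel_measurable (P i)"
        using W_integrable[OF g, of i] by auto
    qed
  qed (use f_diff_sq_integrable[OF g g0_in] in auto)
  also have "\<dots> = 4 * f_dist i g g0"
    using f_diff_sq_integrable[OF g g0_in, of i] by (simp add: f_dist_def)
  finally show ?thesis .
qed

definition W_full :: "nat \<Rightarrow> 'w \<Rightarrow> real" where
  "W_full i \<omega> = W i (Z n i \<omega>) (A (data_vec Z n \<omega>))"

definition W_loo :: "nat \<Rightarrow> nat \<Rightarrow> 'w \<Rightarrow> real" where
  "W_loo i j \<omega> = W i (Z n i \<omega>) (\<Gamma> i j (dat \<omega>))"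

lemma W_full_meas[measurable]: "W_full i \<in> borel_measurable M"
  unfolding W_full_def[abs_def] by measurable

lemma W_loo_meas[measurable]: "W_loo i j \<in> borel_measurable M"
  unfolding W_loo_def[abs_def] by measurable

lemma W_full_bound: "\<omega> \<in> space M \<Longrightarrow> \<bar>W_full i \<omega>\<bar> \<le> 4 * C"
  unfolding W_full_def by (rule W_bound) (auto intro!: A_in measurable_space[OF data_vec_meas(1)])

lemma W_loo_bound: "\<omega> \<in> space M \<Longrightarrow> \<bar>W_loo i j \<omega>\<bar> \<le> 4 * C"
  unfolding W_loo_def by (rule W_bound) (auto intro!: Gamma_in dat_in)

lemma W_prod_integrable:
  "integrable M (\<lambda>\<omega>. W_loo i j \<omega> * W_loo k l \<omega>)"
  "integrable M (\<lambda>\<omega>. W_loo i j \<omega> * W_full k \<omega>)"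
  "integrable M (\<lambda>\<omega>. W_full i \<omega> * W_full k \<omega>)"
  by (rule integrable_bounded[where K="(4*C)*(4*C)"], measurable, rule mult_bound,
      use W_loo_bound W_full_bound in auto)+

lemma diff_bound: "\<bar>a\<bar> \<le> 4 * C \<Longrightarrow> \<bar>b\<bar> \<le> 4 * C \<Longrightarrow> \<bar>a - b\<bar> \<le> 8 * C"
  by linarith

lemma W_diff_sq_integrable:
  "integrable M (\<lambda>\<omega>. (W_loo i j \<omega> - W_loo k l \<omega>)\<^sup>2)"
  "integrable M (\<lambda>\<omega>. (W_full i \<omega> - W_loo k l \<omega>)\<^sup>2)"
proof -
  show "integrable M (\<lambda>\<omega>. (W_loo i j \<omega> - W_loo k l \<omega>)\<^sup>2)"
    unfolding power2_eq_square
    by (rule integrable_bounded[where K="(8*C)*(8*C)"], measurable, rule mult_bound)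
       (intro diff_bound W_loo_bound; assumption)+
  show "integrable M (\<lambda>\<omega>. (W_full i \<omega> - W_loo k l \<omega>)\<^sup>2)"
    unfolding power2_eq_square
    by (rule integrable_bounded[where K="(8*C)*(8*C)"], measurable, rule mult_bound)
       (intro diff_bound W_loo_bound W_full_bound; assumption)+
qed

end

section \<open>Second-moment bound for a fixed sample size\<close>

locale stable_loo_learning = loo_learning +
  fixes e c :: real
  assumes stable: "\<And>i j. i < n \<Longrightarrow> j < n \<Longrightarrow>
      (\<integral>\<omega>. (f (Z n i \<omega>) (A (data_vec Z n \<omega>)) - f (Z n i \<omega>) (\<Gamma> i j (dat \<omega>)))\<^sup>2 \<partial>M) \<le> e"
    and stable_copy: "\<And>i j. i < n \<Longrightarrow> j < n \<Longrightarrow>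
      (\<integral>\<omega>. f_dist i (A (data_vec Z n \<omega>)) (\<Gamma> i j (dat \<omega>)) \<partial>M) \<le> e"
    and consistent: "\<And>i. i < n \<Longrightarrow> (\<integral>\<omega>. f_dist i (\<Gamma> i i (dat \<omega>)) g0 \<partial>M) \<le> c"
begin

lemma W_full_loo:
  assumes ij: "i < n" "j < n"
  shows "(\<integral>\<omega>. (W_full i \<omega> - W_loo i j \<omega>)\<^sup>2 \<partial>M) \<le> 4 * e"
proof -
  let ?a = "\<lambda>\<omega>. (f (Z n i \<omega>) (A (data_vec Z n \<omega>)) - f (Z n i \<omega>) (\<Gamma> i j (dat \<omega>)))\<^sup>2"
  let ?b = "\<lambda>\<omega>. f_dist i (A (data_vec Z n \<omega>)) (\<Gamma> i j (dat \<omega>))"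
  have in_G: "A (data_vec Z n \<omega>) \<in> space G" "\<Gamma> i j (dat \<omega>) \<in> space G" if "\<omega> \<in> space M" for \<omega>
    using that by (auto intro!: A_in measurable_space[OF data_vec_meas(1)] Gamma_in dat_in)
  have ia: "integrable M ?a"
    by (rule integrable_bounded[where K="4 * C\<^sup>2"], measurable) (rule f_diff_sq_bound[OF in_G])
  have ib: "integrable M ?b"
    by (rule integrable_bounded[where K="4 * C\<^sup>2"], measurable) (use f_dist_bound[OF in_G] in auto)
  have "(\<integral>\<omega>. (W_full i \<omega> - W_loo i j \<omega>)\<^sup>2 \<partial>M) \<le> (\<integral>\<omega>. 2 * ?a \<omega> + 2 * ?b \<omega> \<partial>M)"
    by (rule integral_mono)
       (use ia ib W_diff_sq_integrable(2) W_diff_sq_le in_G in \<open>auto simp: W_full_def W_loo_def\<close>)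
  also have "\<dots> = 2 * (\<integral>\<omega>. ?a \<omega> \<partial>M) + 2 * (\<integral>\<omega>. ?b \<omega> \<partial>M)"
    using ia ib by simp
  also have "\<dots> \<le> 4 * e" using stable[OF ij] stable_copy[OF ij] by simp
  finally show ?thesis .
qed

text \<open>Stability compares resampled outputs with the full-sample one only, so two of them are
  compared through \<open>W_full\<close>: twice \<open>4 * e\<close> for each leg.\<close>

lemma W_loo_loo:
  assumes ij: "i < n" "j < n"
  shows "(\<integral>\<omega>. (W_loo i i \<omega> - W_loo i j \<omega>)\<^sup>2 \<partial>M) \<le> 16 * e"
proof -
  have "(\<integral>\<omega>. (W_loo i i \<omega> - W_loo i j \<omega>)\<^sup>2 \<partial>M)
     \<le> (\<integral>\<omega>. 2 * (W_full i \<omega> - W_loo i j \<omega>)\<^sup>2 + 2 * (W_full i \<omega> - W_loo i i \<omega>)\<^sup>2 \<partial>M)"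
  proof (rule integral_mono)
    show "(W_loo i i \<omega> - W_loo i j \<omega>)\<^sup>2 \<le> 2 * (W_full i \<omega> - W_loo i j \<omega>)\<^sup>2 + 2 * (W_full i \<omega> - W_loo i i \<omega>)\<^sup>2" for \<omega>
      using diff_sq_le[of "W_full i \<omega> - W_loo i j \<omega>" "W_full i \<omega> - W_loo i i \<omega>"] by simp
  qed (use W_diff_sq_integrable in auto)
  also have "\<dots> \<le> 16 * e"
    using W_full_loo[OF ij] W_full_loo[OF ij(1) ij(1)] W_diff_sq_integrable by simp
  finally show ?thesis .
qed

text \<open>The output resampled at \<open>i\<close> ignores the data near \<open>i\<close>.
  Decoupling therefore replaces \<open>Z n i\<close> by a fresh observation at cost
  \<open>4 * ((4*C)*(4*C)) * \<beta>\<close>, and the conditional second moment is at most four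
  times \<open>f_dist\<close>.\<close>

lemma W_loo_sq:
  assumes i: "i < n"
  shows "(\<integral>\<omega>. (W_loo i i \<omega>)\<^sup>2 \<partial>M) \<le> 4 * c + 64 * C\<^sup>2 * \<beta>"
proof -
  let ?h = "\<lambda>(x, w). (W i x (\<Gamma> i i w))\<^sup>2"
  have "\<bar>(\<integral>\<omega>. ?h (Z n i \<omega>, dat \<omega>) \<partial>M) - (\<integral>\<omega>. (\<integral>x. ?h (x, dat \<omega>) \<partial>P i) \<partial>M)\<bar> \<le> 4 * ((4*C)*(4*C)) * \<beta>"
  proof (rule expectation_decouple[OF i])
    show "?h \<in> borel_measurable (borel \<Otimes>\<^sub>M (V \<Otimes>\<^sub>M V))" by measurable
    show "\<bar>?h (x, w)\<bar> \<le> (4*C)*(4*C)" if "w \<in> space (V \<Otimes>\<^sub>M V)" for x w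
      using mult_bound[OF W_bound W_bound, OF Gamma_in[OF that] Gamma_in[OF that], of i x i i i x i i]
      by (simp add: power2_eq_square)
    show "?h (x, (mask i z, t)) = ?h (x, (z, t))" for x z t by (simp add: loo_mask)
  qed (use C_pos in simp)
  moreover have "(\<integral>\<omega>. (\<integral>x. ?h (x, dat \<omega>) \<partial>P i) \<partial>M) \<le> 4 * c"
  proof -
    interpret Pi: prob_space "P i" by (rule prob_space_P)
    have "(\<integral>\<omega>. (\<integral>x. ?h (x, dat \<omega>) \<partial>P i) \<partial>M) \<le> (\<integral>\<omega>. 4 * f_dist i (\<Gamma> i i (dat \<omega>)) g0 \<partial>M)"
    proof (rule integral_mono)
      show "integrable M (\<lambda>\<omega>. 4 * f_dist i (\<Gamma> i i (dat \<omega>)) g0)"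
        by (rule integrable_bounded[where K="16 * C\<^sup>2"])
           (use f_dist_bound[OF Gamma_in[OF dat_in] g0_in] in \<open>auto\<close>)
      show le: "(\<integral>x. ?h (x, dat \<omega>) \<partial>P i) \<le> 4 * f_dist i (\<Gamma> i i (dat \<omega>)) g0" if "\<omega> \<in> space M" for \<omega>
        using W_sq_mean_le[OF Gamma_in[OF dat_in[OF that]]] by simp
      show "integrable M (\<lambda>\<omega>. \<integral>x. ?h (x, dat \<omega>) \<partial>P i)"
      proof (rule integrable_bounded[where K="16 * C\<^sup>2"])
        show "(\<lambda>\<omega>. \<integral>x. ?h (x, dat \<omega>) \<partial>P i) \<in> borel_measurable M" by measurable
        fix \<omega> assume w: "\<omega> \<in> space M"
        have "0 \<le> (\<integral>x. ?h (x, dat \<omega>) \<partial>P i)" by (rule integral_nonneg_AE) auto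
        then show "\<bar>\<integral>x. ?h (x, dat \<omega>) \<partial>P i\<bar> \<le> 16 * C\<^sup>2"
          using le[OF w] f_dist_bound(2)[OF Gamma_in[OF dat_in[OF w]] g0_in, of i i i] by linarith
      qed
    qed
    also have "\<dots> \<le> 4 * c" using consistent[OF i] by simp
    finally show ?thesis .
  qed
  ultimately show ?thesis unfolding W_loo_def by (simp add: power2_eq_square)
qed

text \<open>|ab| <= (a^2 + b^2) / 2 is enough, as both squares obey the same bound. It serves the
  pairs for which distance gives no cancellation, the diagonal included when \<open>i\<close> lies
  in \<open>N i\<close>.\<close>

lemma W_loo_near:
  assumes i: "i < n" "j < n"
  shows "\<bar>\<integral>\<omega>. W_loo i i \<omega> * W_loo j j \<omega> \<partial>M\<bar> \<le> 4 * c + 64 * C\<^sup>2 * \<beta>"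
proof -
  have sq: "integrable M (\<lambda>\<omega>. (W_loo i i \<omega>)\<^sup>2)" for i
    using W_prod_integrable(1)[of i i i i] by (simp add: power2_eq_square)
  have "\<bar>\<integral>\<omega>. W_loo i i \<omega> * W_loo j j \<omega> \<partial>M\<bar> \<le> (\<integral>\<omega>. \<bar>W_loo i i \<omega> * W_loo j j \<omega>\<bar> \<partial>M)"
    by (rule integral_abs_bound)
  also have "\<dots> \<le> (\<integral>\<omega>. ((W_loo i i \<omega>)\<^sup>2 + (W_loo j j \<omega>)\<^sup>2) / 2 \<partial>M)"
  proof (rule integral_mono)
    show "\<bar>W_loo i i \<omega> * W_loo j j \<omega>\<bar> \<le> ((W_loo i i \<omega>)\<^sup>2 + (W_loo j j \<omega>)\<^sup>2) / 2" for \<omega>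
      using sum_squares_bound[of "\<bar>W_loo i i \<omega>\<bar>" "\<bar>W_loo j j \<omega>\<bar>"] by (simp add: abs_mult)
  qed (use sq W_prod_integrable in auto)
  also have "\<dots> \<le> 4 * c + 64 * C\<^sup>2 * \<beta>"
    using W_loo_sq[OF i(1)] W_loo_sq[OF i(2)] sq by simp
  finally show ?thesis .
qed

text \<open>With \<open>a = W_loo i j\<close>, \<open>b = W_loo j i\<close>, \<open>d = W_loo i i - a\<close> and \<open>d' = W_loo j j - b\<close>, the product
  \<open>W_loo i i * W_loo j j\<close> is \<open>a * W_loo j j + d * b + d * d'\<close>. In the first summand only the last
  factor involves the data near \<open>j\<close>, and only through \<open>Z_j\<close>; in the second only \<open>d\<close> involves the data
  near \<open>i\<close>, and only through \<open>Z_i\<close>. Both are centred in that variable, so only the product of the two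
  small differences is not controlled by the mixing coefficient.\<close>

lemma W_loo_far:
  assumes i: "i < n" "j < n" and far: "j \<notin> N i"
  shows "\<bar>\<integral>\<omega>. W_loo i i \<omega> * W_loo j j \<omega> \<partial>M\<bar> \<le> 192 * C\<^sup>2 * \<beta> + 16 * e"
proof -
  have far': "i \<notin> N j" using far i by (auto simp: nbhd_def rho_sym)
  note [measurable] = measurable_component_singleton[of _ "{..<n}" "\<lambda>_. borel", OF lessThan_iff[THEN iffD2, OF i(1)]]
    measurable_component_singleton[of _ "{..<n}" "\<lambda>_. borel", OF lessThan_iff[THEN iffD2, OF i(2)]]
  have Zi: "fst (dat \<omega>) i = Z n i \<omega>" "fst (dat \<omega>) j = Z n j \<omega>" for \<omega>
    using i by (auto simp: dat_def data_vec_def)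
  have 1: "\<bar>\<integral>\<omega>. W_loo i j \<omega> * W_loo j j \<omega> \<partial>M\<bar> \<le> 64 * C\<^sup>2 * \<beta>"
  proof -
    \<comment> \<open>The observation at \<open>j\<close> enters as the free argument
      \<open>x\<close>; the one at \<open>i\<close> is read from \<open>w\<close> and survives
      masking at \<open>j\<close> by \<open>far'\<close>.\<close>
    let ?h = "\<lambda>(x, w). W i (fst w i) (\<Gamma> i j w) * W j x (\<Gamma> j j w)"
    have "\<bar>(\<integral>\<omega>. ?h (Z n j \<omega>, dat \<omega>) \<partial>M) - (\<integral>\<omega>. (\<integral>x. ?h (x, dat \<omega>) \<partial>P j) \<partial>M)\<bar> \<le> 4 * ((4*C)*(4*C)) * \<beta>"
    proof (rule expectation_decouple[OF i(2)])
      show "?h \<in> borel_measurable (borel \<Otimes>\<^sub>M (V \<Otimes>\<^sub>M V))" by measurable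
      show "\<bar>?h (x, w)\<bar> \<le> (4*C)*(4*C)" if "w \<in> space (V \<Otimes>\<^sub>M V)" for x w
        using that mult_bound[OF W_bound W_bound, OF Gamma_in Gamma_in] by simp
      show "?h (x, (mask j z, t)) = ?h (x, (z, t))" for x z t
        using mask_other[OF i(1) far'] by (simp add: loo_mask)
    qed (use C_pos in simp)
    moreover have "(\<integral>\<omega>. (\<integral>x. ?h (x, dat \<omega>) \<partial>P j) \<partial>M) = (\<integral>\<omega>. 0 \<partial>M)"
      by (rule Bochner_Integration.integral_cong) (auto simp: W_mean Gamma_in dat_in)
    ultimately show ?thesis unfolding W_loo_def by (simp add: Zi power2_eq_square)
  qed
  have 2: "\<bar>\<integral>\<omega>. (W_loo i i \<omega> - W_loo i j \<omega>) * W_loo j i \<omega> \<partial>M\<bar> \<le> 128 * C\<^sup>2 * \<beta>"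
  proof -
    let ?h = "\<lambda>(x, w). (W i x (\<Gamma> i i w) - W i x (\<Gamma> i j w)) * W j (fst w j) (\<Gamma> j i w)"
    have "\<bar>(\<integral>\<omega>. ?h (Z n i \<omega>, dat \<omega>) \<partial>M) - (\<integral>\<omega>. (\<integral>x. ?h (x, dat \<omega>) \<partial>P i) \<partial>M)\<bar> \<le> 4 * ((8*C)*(4*C)) * \<beta>"
    proof (rule expectation_decouple[OF i(1)])
      show "?h \<in> borel_measurable (borel \<Otimes>\<^sub>M (V \<Otimes>\<^sub>M V))" by measurable
      show "\<bar>?h (x, w)\<bar> \<le> (8*C)*(4*C)" if w: "w \<in> space (V \<Otimes>\<^sub>M V)" for x w
      proof -
        have "\<bar>W i x (\<Gamma> i i w) - W i x (\<Gamma> i j w)\<bar> \<le> 8 * C"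
          using W_bound[OF Gamma_in[OF w], of i x i i] W_bound[OF Gamma_in[OF w], of i x i j] by linarith
        from mult_bound[OF this W_bound[OF Gamma_in[OF w]]] show ?thesis by simp
      qed
      show "?h (x, (mask i z, t)) = ?h (x, (z, t))" for x z t
        using mask_other[OF i(2) far] by (simp add: loo_mask)
    qed (use C_pos in simp)
    moreover have "(\<integral>\<omega>. (\<integral>x. ?h (x, dat \<omega>) \<partial>P i) \<partial>M) = (\<integral>\<omega>. 0 \<partial>M)"
      by (rule Bochner_Integration.integral_cong) (auto simp: W_mean W_integrable Gamma_in dat_in)
    ultimately show ?thesis unfolding W_loo_def by (simp add: Zi power2_eq_square)
  qed
  have 3: "\<bar>\<integral>\<omega>. (W_loo i i \<omega> - W_loo i j \<omega>) * (W_loo j j \<omega> - W_loo j i \<omega>) \<partial>M\<bar> \<le> 16 * e"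
  proof -
    have "\<bar>\<integral>\<omega>. (W_loo i i \<omega> - W_loo i j \<omega>) * (W_loo j j \<omega> - W_loo j i \<omega>) \<partial>M\<bar>
      \<le> (\<integral>\<omega>. \<bar>(W_loo i i \<omega> - W_loo i j \<omega>) * (W_loo j j \<omega> - W_loo j i \<omega>)\<bar> \<partial>M)"
      by (rule integral_abs_bound)
    also have "\<dots> \<le> (\<integral>\<omega>. ((W_loo i i \<omega> - W_loo i j \<omega>)\<^sup>2 + (W_loo j j \<omega> - W_loo j i \<omega>)\<^sup>2) / 2 \<partial>M)"
    proof (rule integral_mono)
      show "\<bar>(W_loo i i \<omega> - W_loo i j \<omega>) * (W_loo j j \<omega> - W_loo j i \<omega>)\<bar>
        \<le> ((W_loo i i \<omega> - W_loo i j \<omega>)\<^sup>2 + (W_loo j j \<omega> - W_loo j i \<omega>)\<^sup>2) / 2" for \<omega>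
        using sum_squares_bound[of "\<bar>W_loo i i \<omega> - W_loo i j \<omega>\<bar>" "\<bar>W_loo j j \<omega> - W_loo j i \<omega>\<bar>"]
        by (simp add: abs_mult)
      have "(W_loo i i \<omega> - W_loo i j \<omega>) * (W_loo j j \<omega> - W_loo j i \<omega>) =
        W_loo i i \<omega> * W_loo j j \<omega> - W_loo i i \<omega> * W_loo j i \<omega> - (W_loo i j \<omega> * W_loo j j \<omega> - W_loo i j \<omega> * W_loo j i \<omega>)" for \<omega>
        by (simp add: algebra_simps)
      then show "integrable M (\<lambda>\<omega>. \<bar>(W_loo i i \<omega> - W_loo i j \<omega>) * (W_loo j j \<omega> - W_loo j i \<omega>)\<bar>)"
        using W_prod_integrable by simp
    qed (use W_diff_sq_integrable in auto)
    also have "\<dots> \<le> 16 * e"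
      using W_loo_loo[OF i] W_loo_loo[OF i(2) i(1)] W_diff_sq_integrable by simp
    finally show ?thesis .
  qed
  have "(\<integral>\<omega>. W_loo i i \<omega> * W_loo j j \<omega> \<partial>M) = (\<integral>\<omega>. W_loo i j \<omega> * W_loo j j \<omega> +
     ((W_loo i i \<omega> - W_loo i j \<omega>) * W_loo j i \<omega> + (W_loo i i \<omega> - W_loo i j \<omega>) * (W_loo j j \<omega> - W_loo j i \<omega>)) \<partial>M)"
    by (rule Bochner_Integration.integral_cong) (auto simp: algebra_simps)
  also have "\<dots> = (\<integral>\<omega>. W_loo i j \<omega> * W_loo j j \<omega> \<partial>M) +
     ((\<integral>\<omega>. (W_loo i i \<omega> - W_loo i j \<omega>) * W_loo j i \<omega> \<partial>M) +
      (\<integral>\<omega>. (W_loo i i \<omega> - W_loo i j \<omega>) * (W_loo j j \<omega> - W_loo j i \<omega>) \<partial>M))"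
    using W_prod_integrable
    by (simp only: left_diff_distrib right_diff_distrib Bochner_Integration.integral_add
         Bochner_Integration.integral_diff Bochner_Integration.integrable_add
         Bochner_Integration.integrable_diff)
  finally show ?thesis using 1 2 3 by linarith
qed

text \<open>The coefficient 40 is 2 * 4 from replacing the full-sample output plus 2 * 16 from the
  far pairs; 384 is 2 * 192.\<close>

lemma second_moment:
  "(\<integral>\<omega>. (\<Sum>i<n. W_full i \<omega>)\<^sup>2 \<partial>M) \<le> 40 * (real n)\<^sup>2 * e
     + 2 * (\<Sum>i<n. real (card (N i))) * (4 * c + 64 * C\<^sup>2 * \<beta>) + 384 * (real n)\<^sup>2 * C\<^sup>2 * \<beta>"
  (is "_ \<le> ?R")
proof (cases "n = 0")
  case True
  then show ?thesis by simp
next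
  case False
  then have n: "0 < n" by simp
  have near0: "0 \<le> 4 * c + 64 * C\<^sup>2 * \<beta>"
    using W_loo_near[OF n n] by linarith
  have e0: "0 \<le> e"
  proof -
    have "0 \<le> (\<integral>\<omega>. (W_full 0 \<omega> - W_loo 0 0 \<omega>)\<^sup>2 \<partial>M)" by (rule integral_nonneg_AE) auto
    then show ?thesis using W_full_loo[OF n n] by linarith
  qed
  \<comment> \<open>For \<open>h = 0\<close> the decoupling bound reads 0 <= 4 \<beta>.\<close>
  have b0: "0 \<le> \<beta>"
  proof -
    have "0 \<le> 4 * 1 * \<beta>"
      using expectation_decouple[OF n, of "\<lambda>_. 0" 1] by simp
    then show ?thesis by simp
  qed
  have far0: "0 \<le> 192 * C\<^sup>2 * \<beta> + 16 * e" using b0 e0 by simp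
  have dint: "integrable M (\<lambda>\<omega>. \<Sum>i<n. (W_full i \<omega> - W_loo i i \<omega>)\<^sup>2)"
    using W_diff_sq_integrable by auto
  have pint: "integrable M (\<lambda>\<omega>. \<Sum>i<n. \<Sum>j<n. W_loo i i \<omega> * W_loo j j \<omega>)"
    using W_prod_integrable by auto
  have "(\<integral>\<omega>. (\<Sum>i<n. W_full i \<omega>)\<^sup>2 \<partial>M) \<le>
    (\<integral>\<omega>. 2 * (real n * (\<Sum>i<n. (W_full i \<omega> - W_loo i i \<omega>)\<^sup>2))
        + 2 * (\<Sum>i<n. \<Sum>j<n. W_loo i i \<omega> * W_loo j j \<omega>) \<partial>M)"
  proof (rule integral_mono)
    fix \<omega>
    have "(\<Sum>i<n. W_full i \<omega>)\<^sup>2 = ((\<Sum>i<n. W_full i \<omega> - W_loo i i \<omega>) + (\<Sum>i<n. W_loo i i \<omega>))\<^sup>2"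
      by (simp add: sum_subtractf)
    also have "\<dots> \<le> 2 * (\<Sum>i<n. W_full i \<omega> - W_loo i i \<omega>)\<^sup>2 + 2 * (\<Sum>i<n. W_loo i i \<omega>)\<^sup>2"
      by (rule add_sq_le)
    also have "(\<Sum>i<n. W_full i \<omega> - W_loo i i \<omega>)\<^sup>2 \<le> real n * (\<Sum>i<n. (W_full i \<omega> - W_loo i i \<omega>)\<^sup>2)"
      using sum_squared_le_sum_of_squares[of "\<lambda>i. W_full i \<omega> - W_loo i i \<omega>" "{..<n}"]
      by (simp add: mult.commute)
    also have "(\<Sum>i<n. W_loo i i \<omega>)\<^sup>2 = (\<Sum>i<n. \<Sum>j<n. W_loo i i \<omega> * W_loo j j \<omega>)"
      by (simp add: power2_eq_square sum_product)
    finally show "(\<Sum>i<n. W_full i \<omega>)\<^sup>2 \<le> 2 * (real n * (\<Sum>i<n. (W_full i \<omega> - W_loo i i \<omega>)\<^sup>2))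
        + 2 * (\<Sum>i<n. \<Sum>j<n. W_loo i i \<omega> * W_loo j j \<omega>)" by simp
  next
    show "integrable M (\<lambda>\<omega>. (\<Sum>i<n. W_full i \<omega>)\<^sup>2)"
      unfolding power2_eq_square sum_product using W_prod_integrable by auto
  qed (use dint pint in auto)
  also have "\<dots> = 2 * (real n * (\<Sum>i<n. (\<integral>\<omega>. (W_full i \<omega> - W_loo i i \<omega>)\<^sup>2 \<partial>M)))
        + 2 * (\<Sum>i<n. \<Sum>j<n. (\<integral>\<omega>. W_loo i i \<omega> * W_loo j j \<omega> \<partial>M))"
    using dint pint W_prod_integrable W_diff_sq_integrable by simp
  \<comment> \<open>The far bound is nonnegative, so it may be charged to all n^2 pairs; the near
    bound is then added only on the neighbourhoods.\<close>
  also have "\<dots> \<le> 2 * (real n * (\<Sum>i<n. 4 * e)) + 2 * (\<Sum>i<n. \<Sum>j<n.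
      (if j \<in> N i then 4 * c + 64 * C\<^sup>2 * \<beta> else 0) + (192 * C\<^sup>2 * \<beta> + 16 * e))"
  proof (intro add_mono mult_left_mono sum_mono)
    fix i j assume ij: "i \<in> {..<n}" "j \<in> {..<n}"
    then show "(\<integral>\<omega>. W_loo i i \<omega> * W_loo j j \<omega> \<partial>M) \<le>
       (if j \<in> N i then 4 * c + 64 * C\<^sup>2 * \<beta> else 0) + (192 * C\<^sup>2 * \<beta> + 16 * e)"
      using W_loo_near[of i j] W_loo_far[of i j] far0 by (auto simp: abs_le_iff)
  qed (use W_full_loo in auto)
  also have "\<dots> = 8 * (real n)\<^sup>2 * e + 2 * ((\<Sum>i<n. real (card (N i))) * (4 * c + 64 * C\<^sup>2 * \<beta>)
      + (real n)\<^sup>2 * (192 * C\<^sup>2 * \<beta> + 16 * e))"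
  proof -
    have "(\<Sum>j<n. if j \<in> N i then (x::real) else 0) = real (card (N i)) * x" for i x
    proof -
      have "{..<n} \<inter> N i = N i" by (auto simp: nbhd_def)
      then show ?thesis by (simp add: sum.If_cases Int_def)
    qed
    then have "2 * (real n * (\<Sum>i<n. 4 * e)) + 2 * (\<Sum>i<n. \<Sum>j<n. (if j \<in> N i then y else 0) + u)
        = 8 * (real n)\<^sup>2 * e + 2 * ((\<Sum>i<n. real (card (N i))) * y + (real n)\<^sup>2 * u)" for y u
      by (simp add: sum.distrib power2_eq_square sum_distrib_right)
    then show ?thesis .
  qed
  also have "\<dots> = ?R" by (simp add: algebra_simps)
  finally show ?thesis .
qed

end

section \<open>Tail bound by Chebyshev's inequality\<close>

context stable_loo_learning begin

lemma emp_dev_eq: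
  "emp_dev M Z n f (A (data_vec Z n \<omega>)) g0 \<omega> = (\<Sum>i<n. W_full i \<omega>) / real n"
  by (simp add: emp_dev_def W_full_def W_def F_def Fint_def)

text \<open>With these \<open>e\<close> and \<open>c\<close> every term of the second moment carries
  a factor n, which cancels against the n in the squared threshold. In the mixing terms the total
  neighbourhood size is bounded crudely by n^2, whence 512 = 128 + 384.\<close>

lemma deviation_tail:
  assumes n: "0 < n" and e: "e = \<epsilon>\<^sup>2 / real n" and c: "c = L * (\<epsilon> / avg_nbhd rho n r)"
    and L: "L > 0" "\<epsilon> > 0" and \<eta>: "\<eta> > 0"
  shows "prob {\<omega> \<in> space M. sqrt (real n) * \<bar>emp_dev M Z n f (A (data_vec Z n \<omega>)) g0 \<omega>\<bar> > \<eta>}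
     \<le> (40 * \<epsilon>\<^sup>2 + 8 * L * \<epsilon> + 512 * C\<^sup>2 * (real n * \<beta>)) / \<eta>\<^sup>2"
proof -
  let ?S = "\<lambda>\<omega>. \<Sum>i<n. W_full i \<omega>"
  let ?N = "\<Sum>i<n. real (card (N i))"
  have b0: "0 \<le> \<beta>"
    using expectation_decouple[OF n, of "\<lambda>_. 0" 1] by simp
  have cardN: "real (card (N i)) \<le> real n" for i
    using card_mono[of "{..<n}" "N i"] by (auto simp: nbhd_def)
  have N: "?N \<le> (real n)\<^sup>2"
    using sum_mono[of "{..<n}" "\<lambda>i. real (card (N i))" "\<lambda>_. real n"] cardN by (simp add: power2_eq_square)
  \<comment> \<open>For nonzero \<open>?N\<close> this is an equality, since \<open>avg_nbhd\<close>
    is \<open>?N / real n\<close>; otherwise the left side is 0.\<close>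
  have Nc: "?N * c \<le> real n * (L * \<epsilon>)"
    using n L by (cases "?N = 0") (auto simp: c avg_nbhd_def)
  have "(\<integral>\<omega>. (?S \<omega>)\<^sup>2 \<partial>M) \<le> 40 * (real n)\<^sup>2 * e
     + 2 * ?N * (4 * c + 64 * C\<^sup>2 * \<beta>) + 384 * (real n)\<^sup>2 * C\<^sup>2 * \<beta>" by (rule second_moment)
  also have "\<dots> = 40 * (real n)\<^sup>2 * e + 8 * (?N * c) + 128 * (C\<^sup>2 * \<beta>) * ?N + 384 * (real n)\<^sup>2 * C\<^sup>2 * \<beta>"
    by (simp add: algebra_simps)
  also have "\<dots> \<le> 40 * (real n)\<^sup>2 * e + 8 * (real n * (L * \<epsilon>)) + 128 * (C\<^sup>2 * \<beta>) * (real n)\<^sup>2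
      + 384 * (real n)\<^sup>2 * C\<^sup>2 * \<beta>"
    using Nc N b0 by (intro add_mono mult_left_mono) auto
  also have "\<dots> = real n * (40 * \<epsilon>\<^sup>2 + 8 * L * \<epsilon> + 512 * C\<^sup>2 * (real n * \<beta>))"
    using n by (simp add: e field_simps power2_eq_square)
  finally have moment: "(\<integral>\<omega>. (?S \<omega>)\<^sup>2 \<partial>M) \<le> real n * (40 * \<epsilon>\<^sup>2 + 8 * L * \<epsilon> + 512 * C\<^sup>2 * (real n * \<beta>))" .
  have scale: "sqrt (real n) * \<bar>s / real n\<bar> = \<bar>s\<bar> / sqrt (real n)" for s
    using n by (simp add: abs_divide real_div_sqrt field_simps)
  have "prob {\<omega> \<in> space M. sqrt (real n) * \<bar>emp_dev M Z n f (A (data_vec Z n \<omega>)) g0 \<omega>\<bar> > \<eta>}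
     \<le> prob {\<omega> \<in> space M. \<bar>?S \<omega>\<bar> \<ge> \<eta> * sqrt (real n)}"
    using n unfolding emp_dev_eq scale
    by (intro finite_measure_mono) (auto simp: field_simps)
  also have "\<dots> \<le> expectation (\<lambda>\<omega>. (?S \<omega>)\<^sup>2) / (\<eta> * sqrt (real n))\<^sup>2"
  proof (rule second_moment_method)
    show "integrable M (\<lambda>\<omega>. (?S \<omega>)\<^sup>2)"
      unfolding power2_eq_square sum_product using W_prod_integrable by auto
  qed (use n \<eta> in auto)
  also have "\<dots> \<le> real n * (40 * \<epsilon>\<^sup>2 + 8 * L * \<epsilon> + 512 * C\<^sup>2 * (real n * \<beta>)) / (\<eta> * sqrt (real n))\<^sup>2"
    by (rule divide_right_mono[OF moment]) simp
  also have "\<dots> = (40 * \<epsilon>\<^sup>2 + 8 * L * \<epsilon> + 512 * C\<^sup>2 * (real n * \<beta>)) / \<eta>\<^sup>2"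
    using n by (simp add: power_mult_distrib)
  finally show ?thesis .
qed

end

section \<open>From the hypotheses of the theorem to bounds on \<open>f_dist\<close>\<close>

context loo_learning begin

lemma f_dist_eq:
  assumes "g \<in> space G" "g' \<in> space G"
  shows "f_dist i g g' = (\<integral>\<omega>. (f (Z n i \<omega>) g - f (Z n i \<omega>) g')\<^sup>2 \<partial>M)"
  unfolding f_dist_def by (rule integral_distr) (use assms in measurable)

text \<open>The type of \<open>indep_var\<close> forces both variables into one type, so independence of the pair
  \<open>dat\<close> from \<open>X\<close> is expressed through maps out of independent variables \<open>U\<close> and \<open>Y\<close>.\<close>

lemma expectation_f_dist_copy:
  assumes ind: "indep_var N1 U N2 Y" and \<phi>: "\<phi> \<in> N1 \<rightarrow>\<^sub>M V \<Otimes>\<^sub>M V" and \<psi>: "\<psi> \<in> N2 \<rightarrow>\<^sub>M V"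
    and dat: "\<And>\<omega>. dat \<omega> = \<phi> (U \<omega>)" and X: "\<And>\<omega>. X \<omega> = \<psi> (Y \<omega>)"
    and law: "distr M V X = distr M V (data_vec Z n)"
    and i: "i < n" and g: "u \<in> V \<Otimes>\<^sub>M V \<rightarrow>\<^sub>M G" "v \<in> V \<Otimes>\<^sub>M V \<rightarrow>\<^sub>M G"
  shows "(\<integral>\<omega>. (f (X \<omega> i) (u (dat \<omega>)) - f (X \<omega> i) (v (dat \<omega>)))\<^sup>2 \<partial>M)
    = (\<integral>\<omega>. f_dist i (u (dat \<omega>)) (v (dat \<omega>)) \<partial>M)"
proof -
  have Vi: "(\<lambda>z. z i) \<in> V \<rightarrow>\<^sub>M borel"
    by (rule measurable_component_singleton) (use i in simp)
  have U: "U \<in> M \<rightarrow>\<^sub>M N1" and Y: "Y \<in> M \<rightarrow>\<^sub>M N2" using ind by (auto simp: indep_var_distribution_eq)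
  have X_meas: "X \<in> M \<rightarrow>\<^sub>M V" unfolding X[abs_def] by (rule measurable_compose[OF Y \<psi>])
  let ?k = "\<lambda>(p, y). (f (\<psi> y i) (u (\<phi> p)) - f (\<psi> y i) (v (\<phi> p)))\<^sup>2"
  have k: "?k \<in> borel_measurable (N1 \<Otimes>\<^sub>M N2)"
    unfolding case_prod_beta
    by (intro borel_measurable_power borel_measurable_diff f_meas'
        measurable_compose[OF measurable_snd measurable_compose[OF \<psi> Vi]]
        measurable_compose[OF measurable_fst measurable_compose[OF \<phi> g(1)]]
        measurable_compose[OF measurable_fst measurable_compose[OF \<phi> g(2)]])
  have "(\<integral>\<omega>. ?k (U \<omega>, Y \<omega>) \<partial>M) = (\<integral>\<omega>. (\<integral>y. ?k (U \<omega>, y) \<partial>distr M N2 Y) \<partial>M)"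
    by (rule expectation_indep_pair[OF ind k, where K="4 * C\<^sup>2"])
       (use f_diff_sq_bound g[THEN measurable_space] \<phi>[THEN measurable_space] in auto)
  also have "\<dots> = (\<integral>\<omega>. f_dist i (u (dat \<omega>)) (v (dat \<omega>)) \<partial>M)"
  proof (rule Bochner_Integration.integral_cong[OF refl])
    fix \<omega> assume w: "\<omega> \<in> space M"
    then have in_G: "u (dat \<omega>) \<in> space G" "v (dat \<omega>) \<in> space G"
      using dat_in g[THEN measurable_space] by auto
    let ?d = "\<lambda>s. (f (s i) (u (dat \<omega>)) - f (s i) (v (dat \<omega>)))\<^sup>2"
    have d: "?d \<in> borel_measurable V"
      using in_G by (intro borel_measurable_power borel_measurable_diff f_meas' Vi) simp_all
    have "(\<integral>y. ?k (U \<omega>, y) \<partial>distr M N2 Y) = (\<integral>\<omega>'. ?k (U \<omega>, Y \<omega>') \<partial>M)"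
      by (rule integral_distr[OF Y]) (rule measurable_compose[OF measurable_Pair1'[OF measurable_space[OF U w]] k])
    also have "\<dots> = (\<integral>\<omega>'. ?d (X \<omega>') \<partial>M)" by (simp add: dat X)
    also have "\<dots> = (\<integral>s. ?d s \<partial>distr M V X)" by (rule integral_distr[symmetric, OF X_meas d])
    also have "\<dots> = (\<integral>\<omega>'. ?d (data_vec Z n \<omega>') \<partial>M)"
      unfolding law by (rule integral_distr[OF data_vec_meas(1) d])
    finally show "(\<integral>y. ?k (U \<omega>, y) \<partial>distr M N2 Y) = f_dist i (u (dat \<omega>)) (v (dat \<omega>))"
      using i by (simp add: f_dist_eq[OF in_G] data_vec_def)
  qed
  finally show ?thesis by (simp add: dat X)
qed

text \<open>\<open>B\<close> stands for a power of an L2 norm that may be infinite at some points,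
  so the comparison is made between nonnegative integrals; only \<open>f_dist\<close>, which is
  bounded, returns to real integrals.\<close>

lemma expectation_f_dist_le:
  assumes u[measurable]: "u \<in> M \<rightarrow>\<^sub>M G" and L: "L > 0" and q: "q \<ge> 0"
    and dom: "\<And>\<omega>. \<omega> \<in> space M \<Longrightarrow> ennreal (f_dist i (u \<omega>) g0) \<le> ennreal L * B \<omega>"
    and B: "(\<integral>\<^sup>+\<omega>. B \<omega> \<partial>M) \<le> ennreal q"
  shows "(\<integral>\<omega>. f_dist i (u \<omega>) g0 \<partial>M) \<le> L * q"
proof -
  have u_in: "\<omega> \<in> space M \<Longrightarrow> u \<omega> \<in> space G" for \<omega> by (rule measurable_space[OF u])
  have int: "integrable M (\<lambda>\<omega>. f_dist i (u \<omega>) g0 / L)"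
    using f_dist_bound[OF u_in g0_in] 
    by (intro integrable_divide_zero integrable_bounded[where K="4 * C\<^sup>2"]) auto
  have "ennreal (\<integral>\<omega>. f_dist i (u \<omega>) g0 / L \<partial>M) = (\<integral>\<^sup>+\<omega>. ennreal (f_dist i (u \<omega>) g0 / L) \<partial>M)"
    using f_dist_bound(1)[OF u_in g0_in] L by (intro nn_integral_eq_integral[symmetric] int) auto
  also have "\<dots> \<le> (\<integral>\<^sup>+\<omega>. B \<omega> \<partial>M)"
  proof (rule nn_integral_mono)
    fix \<omega> assume w: "\<omega> \<in> space M"
    have "ennreal (f_dist i (u \<omega>) g0 / L) = ennreal (1 / L) * ennreal (f_dist i (u \<omega>) g0)"
      using f_dist_bound(1)[OF u_in[OF w] g0_in] L by (simp add: ennreal_mult[symmetric])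
    also have "\<dots> \<le> ennreal (1 / L) * (ennreal L * B \<omega>)"
      by (rule mult_left_mono[OF dom[OF w]]) simp
    also have "\<dots> = B \<omega>"
      using L by (simp add: mult.assoc[symmetric] ennreal_mult[symmetric])
    finally show "ennreal (f_dist i (u \<omega>) g0 / L) \<le> B \<omega>" .
  qed
  also note B
  finally have "(\<integral>\<omega>. f_dist i (u \<omega>) g0 / L \<partial>M) \<le> q" using q by (simp add: ennreal_le_iff)
  then show ?thesis using L by (simp add: field_simps)
qed

end

theorem theorem1:
  fixes M :: "'w measure"
    and Z Zt Zs :: "nat \<Rightarrow> nat \<Rightarrow> 'w \<Rightarrow> 'z::euclidean_space"
    and rho :: "nat \<Rightarrow> nat \<Rightarrow> nat \<Rightarrow> real"
    and G :: "('z \<Rightarrow> 'd::euclidean_space) measure"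
    and g0 :: "'z \<Rightarrow> 'd"
    and A :: "nat \<Rightarrow> (nat \<Rightarrow> 'z) \<Rightarrow> ('z \<Rightarrow> 'd)"
    and psi :: "'z \<Rightarrow> ('z \<Rightarrow> 'd) \<Rightarrow> nat \<Rightarrow> nat \<Rightarrow> real"
    and nu :: "'z \<Rightarrow> ('z \<Rightarrow> 'd) \<Rightarrow> nat \<Rightarrow> real"
    and p :: nat
    and r :: "nat \<Rightarrow> real"
  assumes M: "prob_space M"
    \<comment> \<open>semi-metric \<rho>_n on [n]\<close>
    and rho_nonneg: "\<And>n i j. rho n i j \<ge> 0"
    and rho_sym: "\<And>n i j. rho n i j = rho n j i"
    and rho_refl: "\<And>n i. rho n i i = 0"
    \<comment> \<open>data and two independent copies with the same joint law\<close>
    and Z_meas: "\<And>n i. Z n i \<in> borel_measurable M"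
    and Zt_meas: "\<And>n i. Zt n i \<in> borel_measurable M"
    and Zs_meas: "\<And>n i. Zs n i \<in> borel_measurable M"
    and Zt_law: "\<And>n. distr M (PiM {..<n} (\<lambda>_. borel)) (data_vec Zt n)
                     = distr M (PiM {..<n} (\<lambda>_. borel)) (data_vec Z n)"
    and Zs_law: "\<And>n. distr M (PiM {..<n} (\<lambda>_. borel)) (data_vec Zs n)
                     = distr M (PiM {..<n} (\<lambda>_. borel)) (data_vec Z n)"
    and indep: "\<And>n. prob_space.indep_vars M (\<lambda>_. PiM {..<n} (\<lambda>_. borel))
                  (\<lambda>c. if c = (0::nat) then data_vec Z n else if c = 1 then data_vec Zt n else data_vec Zs n)
                  {0, 1, 2}"
    \<comment> \<open>the function class, the true nuisance and the (measurable) learner\<close>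
    and G_meas: "\<And>g. g \<in> space G \<Longrightarrow> g \<in> borel_measurable borel"
    and g0_in: "g0 \<in> space G"
    and A_meas: "\<And>n. A n \<in> PiM {..<n} (\<lambda>_. borel) \<rightarrow>\<^sub>M G"
    and psi_meas: "\<And>k l. (\<lambda>(z, g). psi z g k l) \<in> borel_measurable (borel \<Otimes>\<^sub>M G)"
    and nu_meas: "\<And>k. (\<lambda>(z, g). nu z g k) \<in> borel_measurable (borel \<Otimes>\<^sub>M G)"
    and r_nonneg: "\<And>n. r n \<ge> 0"
    \<comment> \<open>(i)(a) bounded ranges\<close>
    and bounded: "\<exists>C. \<forall>z. \<forall>g\<in>space G. \<forall>k<p. \<forall>l<p. \<bar>psi z g k l\<bar> \<le> C \<and> \<bar>nu z g k\<bar> \<le> C"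
    \<comment> \<open>(i)(b) L2-continuity and (iii) learner consistency, sharing the exponent q\<close>
    and cont_consist: "\<exists>L q. L > 0 \<and> q > 0 \<and>
        (\<forall>n i b k l g g'. i < n \<longrightarrow> k < p \<longrightarrow> l < p \<longrightarrow> g \<in> space G \<longrightarrow> g' \<in> space G \<longrightarrow>
           ennreal (\<integral>\<omega>. (fkl psi nu b k l (Z n i \<omega>) g - fkl psi nu b k l (Z n i \<omega>) g')\<^sup>2 \<partial>M)
             \<le> ennreal L * l2pow M Z n i (\<lambda>z. g z - g' z) q) \<and>
        (\<forall>\<epsilon>>0. eventually (\<lambda>n. \<forall>i<n.
           (\<integral>\<^sup>+\<omega>. l2pow M Z n i (\<lambda>z. A n (loo_data rho Z Zt n (r n) i i \<omega>) z - g0 z) q \<partial>M)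
             \<le> ennreal (\<epsilon> / avg_nbhd rho n (r n))) sequentially)"
    \<comment> \<open>(ii) neighbourhood stability\<close>
    and stability: "\<And>b k l \<epsilon>. k < p \<Longrightarrow> l < p \<Longrightarrow> \<epsilon> > 0 \<Longrightarrow>
        eventually (\<lambda>n. \<forall>i<n. \<forall>j<n.
          sqrt (\<integral>\<omega>. (fkl psi nu b k l (Z n i \<omega>) (A n (data_vec Z n \<omega>))
                      - fkl psi nu b k l (Z n i \<omega>) (A n (loo_data rho Z Zt n (r n) i j \<omega>)))\<^sup>2 \<partial>M)
            \<le> \<epsilon> / sqrt (real n) \<and>
          sqrt (\<integral>\<omega>. (fkl psi nu b k l (Zs n i \<omega>) (A n (data_vec Z n \<omega>))
                      - fkl psi nu b k l (Zs n i \<omega>) (A n (loo_data rho Z Zt n (r n) i j \<omega>)))\<^sup>2 \<partial>M)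
            \<le> \<epsilon> / sqrt (real n)) sequentially"
    \<comment> \<open>(iv) weak dependence\<close>
    and weak_dep: "(\<lambda>n. real n * beta_n M Z rho n (r n)) \<longlonglongrightarrow> 0"
  shows "\<forall>b k l. k < p \<longrightarrow> l < p \<longrightarrow> (\<forall>\<epsilon>>0.
           (\<lambda>n. measure M {\<omega> \<in> space M.
                  sqrt (real n) * \<bar>emp_dev M Z n (fkl psi nu b k l) (A n (data_vec Z n \<omega>)) g0 \<omega>\<bar> > \<epsilon>})
           \<longlonglongrightarrow> 0)"
proof (intro allI impI)
  fix b k l and \<eta> :: real
  assume k: "k < p" and l: "l < p" and \<eta>: "\<eta> > 0"
  interpret prob_space M by fact
  define f where "f = fkl psi nu b k l"
  obtain C0 where C0: "\<forall>z. \<forall>g\<in>space G. \<forall>k<p. \<forall>l<p. \<bar>psi z g k l\<bar> \<le> C0 \<and> \<bar>nu z g k\<bar> \<le> C0"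
    using bounded by blast
  \<comment> \<open>Adding 1 makes the bound strictly positive, and the absolute value lets it cover
    the zero off-diagonal entries of \<open>nu\<close>.\<close>
  define C where "C = \<bar>C0\<bar> + 1"
  have f_bound: "\<bar>f z g\<bar> \<le> C" if "g \<in> space G" for z g
  proof -
    have "\<bar>psi z g k l\<bar> \<le> C0" "\<bar>nu z g k\<bar> \<le> C0" using C0 that k l by blast+
    then show ?thesis unfolding f_def fkl_def C_def by (cases b; cases "k = l"; simp)
  qed
  have f_meas: "(\<lambda>(z, g). f z g) \<in> borel_measurable (borel \<Otimes>\<^sub>M G)"
    using psi_meas[of k l] nu_meas[of k] unfolding f_def fkl_def
    by (cases b; cases "k = l") simp_all
  obtain L q where L: "L > 0"
    and cont0: "\<forall>n i b k l g g'. i < n \<longrightarrow> k < p \<longrightarrow> l < p \<longrightarrow> g \<in> space G \<longrightarrow> g' \<in> space G \<longrightarrow>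
           ennreal (\<integral>\<omega>. (fkl psi nu b k l (Z n i \<omega>) g - fkl psi nu b k l (Z n i \<omega>) g')\<^sup>2 \<partial>M)
             \<le> ennreal L * l2pow M Z n i (\<lambda>z. g z - g' z) q"
    and cons: "\<forall>\<epsilon>>0. eventually (\<lambda>n. \<forall>i<n.
           (\<integral>\<^sup>+\<omega>. l2pow M Z n i (\<lambda>z. A n (loo_data rho Z Zt n (r n) i i \<omega>) z - g0 z) q \<partial>M)
             \<le> ennreal (\<epsilon> / avg_nbhd rho n (r n))) sequentially"
    using cont_consist by (elim exE conjE) (rule that)
  have cont: "ennreal (\<integral>\<omega>. (f (Z n i \<omega>) g - f (Z n i \<omega>) g')\<^sup>2 \<partial>M)
             \<le> ennreal L * l2pow M Z n i (\<lambda>z. g z - g' z) q"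
    if "i < n" "g \<in> space G" "g' \<in> space G" for n i g g'
    unfolding f_def using that k l by (intro cont0[rule_format])
  let ?V = "\<lambda>n. PiM {..<n} (\<lambda>_. borel) :: (nat \<Rightarrow> 'z) measure"
  let ?X = "\<lambda>n c. if c = (0::nat) then data_vec Z n else if c = 1 then data_vec Zt n else data_vec Zs n"
  have comp: "(\<lambda>h. h c) \<in> PiM I (\<lambda>_. ?V n) \<rightarrow>\<^sub>M ?V n" if "c \<in> I" for c :: nat and I n
    using that by (rule measurable_component_singleton)
  have setting: "loo_learning M n Z Zt rho G (A n) f C g0" for n
  proof unfold_locales
    have "indep_var (?V n) ((\<lambda>h. h 1) \<circ> (\<lambda>\<omega>. \<lambda>c\<in>{1}. ?X n c \<omega>)) (?V n) ((\<lambda>h. h 0) \<circ> (\<lambda>\<omega>. \<lambda>c\<in>{0}. ?X n c \<omega>))"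
      by (rule indep_var_compose[OF indep_var_restrict[OF indep[of n]] comp comp]) auto
    then show "indep_var (?V n) (data_vec Zt n) (?V n) (data_vec Z n)" by (simp add: o_def)
  qed (use rho_sym Z_meas A_meas f_meas f_bound g0_in in \<open>auto simp: C_def\<close>)
  have tail: "eventually (\<lambda>n. prob {\<omega> \<in> space M. sqrt (real n) *
        \<bar>emp_dev M Z n f (A n (data_vec Z n \<omega>)) g0 \<omega>\<bar> > \<eta>}
      \<le> (40 * \<epsilon>\<^sup>2 + 8 * L * \<epsilon> + 512 * C\<^sup>2 * (real n * beta_n M Z rho n (r n))) / \<eta>\<^sup>2) sequentially"
    if \<epsilon>: "\<epsilon> > 0" for \<epsilon>
    using stability[OF k l \<epsilon>, of b] cons[rule_format, OF \<epsilon>] eventually_gt_at_top[of 0]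
  proof eventually_elim
    case (elim n)
    interpret S: loo_learning M n Z Zt rho "r n" G "A n" f C g0 by (rule setting)
    have sq: "I \<le> \<epsilon>\<^sup>2 / real n" if "sqrt I \<le> \<epsilon> / sqrt (real n)" "0 \<le> I" for I
    proof -
      have "(sqrt I)\<^sup>2 \<le> (\<epsilon> / sqrt (real n))\<^sup>2" using that by (intro power_mono) auto
      then show ?thesis using that by (simp add: power_divide)
    qed
    have "stable_loo_learning M n Z Zt rho (r n) G (A n) f C g0 (\<epsilon>\<^sup>2 / real n)
        (L * (\<epsilon> / avg_nbhd rho n (r n)))"
    proof unfold_locales
      fix i j assume ij: "i < n" "j < n"
      show "(\<integral>\<omega>. (f (Z n i \<omega>) (A n (data_vec Z n \<omega>)) - f (Z n i \<omega>) (A n (S.loo i j (S.dat \<omega>))))\<^sup>2 \<partial>M)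
          \<le> \<epsilon>\<^sup>2 / real n"
        using elim(1) ij by (intro sq integral_nonneg_AE) (auto simp: f_def S.loo_data_eq)
      let ?U = "\<lambda>\<omega>. \<lambda>c\<in>{0, 1}. ?X n c \<omega>" and ?Y = "\<lambda>\<omega>. \<lambda>c\<in>{2}. ?X n c \<omega>"
      \<comment> \<open>The full sample is written as \<open>fst (S.dat \<omega>)\<close> so that
        both outputs are functions of \<open>S.dat\<close>, hence of the first two of the three
        independent data sets.\<close>
      have "(\<integral>\<omega>. (f (data_vec Zs n \<omega> i) (A n (fst (S.dat \<omega>))) - f (data_vec Zs n \<omega> i) (A n (S.loo i j (S.dat \<omega>))))\<^sup>2 \<partial>M)
        = (\<integral>\<omega>. S.f_dist i (A n (fst (S.dat \<omega>))) (A n (S.loo i j (S.dat \<omega>))) \<partial>M)"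
      proof (rule S.expectation_f_dist_copy)
        show "indep_var (PiM {0, 1} (\<lambda>_. ?V n)) ?U (PiM {2} (\<lambda>_. ?V n)) ?Y"
          by (rule indep_var_restrict[OF indep[of n]]) auto
        show "(\<lambda>h. (h 0, h 1)) \<in> PiM {0, 1::nat} (\<lambda>_. ?V n) \<rightarrow>\<^sub>M ?V n \<Otimes>\<^sub>M ?V n"
          by (intro measurable_Pair comp) auto
        show "(\<lambda>h. h 2) \<in> PiM {2::nat} (\<lambda>_. ?V n) \<rightarrow>\<^sub>M ?V n" by (rule comp) simp
      qed (use Zs_law ij in \<open>auto simp: S.dat_def\<close>)
      moreover have "fst (S.dat \<omega>) = data_vec Z n \<omega>" "data_vec Zs n \<omega> i = Zs n i \<omega>" for \<omega>
        using ij by (simp_all add: S.dat_def data_vec_def)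
      ultimately have eq: "(\<integral>\<omega>. S.f_dist i (A n (data_vec Z n \<omega>)) (A n (S.loo i j (S.dat \<omega>))) \<partial>M)
        = (\<integral>\<omega>. (f (Zs n i \<omega>) (A n (data_vec Z n \<omega>)) - f (Zs n i \<omega>) (A n (S.loo i j (S.dat \<omega>))))\<^sup>2 \<partial>M)"
        by simp
      show "(\<integral>\<omega>. S.f_dist i (A n (data_vec Z n \<omega>)) (A n (S.loo i j (S.dat \<omega>))) \<partial>M) \<le> \<epsilon>\<^sup>2 / real n"
        unfolding eq using elim(1) ij
        by (intro sq integral_nonneg_AE) (auto simp: f_def S.loo_data_eq)
    next
      fix i assume i: "i < n"
      show "(\<integral>\<omega>. S.f_dist i (A n (S.loo i i (S.dat \<omega>))) g0 \<partial>M) \<le> L * (\<epsilon> / avg_nbhd rho n (r n))"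
      proof (rule S.expectation_f_dist_le[OF _ L])
        show "(\<lambda>\<omega>. A n (S.loo i i (S.dat \<omega>))) \<in> M \<rightarrow>\<^sub>M G" by measurable
        show "0 \<le> \<epsilon> / avg_nbhd rho n (r n)"
          using \<epsilon> by (simp add: avg_nbhd_def sum_nonneg)
        show "(\<integral>\<^sup>+\<omega>. l2pow M Z n i (\<lambda>z. A n (S.loo i i (S.dat \<omega>)) z - g0 z) q \<partial>M)
            \<le> ennreal (\<epsilon> / avg_nbhd rho n (r n))"
          using elim(2) i by (simp add: S.loo_data_eq)
        fix \<omega> assume "\<omega> \<in> space M"
        then have "A n (S.loo i i (S.dat \<omega>)) \<in> space G" by (intro S.Gamma_in S.dat_in)
        then show "ennreal (S.f_dist i (A n (S.loo i i (S.dat \<omega>))) g0)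
            \<le> ennreal L * l2pow M Z n i (\<lambda>z. A n (S.loo i i (S.dat \<omega>)) z - g0 z) q"
          using cont[OF i _ g0_in] by (simp add: S.f_dist_eq g0_in)
      qed
    qed
    then show ?case
      by (rule stable_loo_learning.deviation_tail) (use elim(3) L \<epsilon> \<eta> in auto)
  qed
  show "(\<lambda>n. prob {\<omega> \<in> space M. sqrt (real n) *
      \<bar>emp_dev M Z n (fkl psi nu b k l) (A n (data_vec Z n \<omega>)) g0 \<omega>\<bar> > \<eta>}) \<longlonglongrightarrow> 0"
    unfolding f_def[symmetric]
  proof (rule order_tendstoI)
    fix a :: real assume "a < 0"
    then show "eventually (\<lambda>n. a < prob {\<omega> \<in> space M. sqrt (real n) *
        \<bar>emp_dev M Z n f (A n (data_vec Z n \<omega>)) g0 \<omega>\<bar> > \<eta>}) sequentially"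
      by (intro always_eventually allI) (meson less_le_trans measure_nonneg)
  next
    fix a :: real assume a: "0 < a"
    \<comment> \<open>\<epsilon> is fixed before n: it makes the stability and consistency share
      smaller than a/2, and the mixing share, which is free of \<epsilon>, falls below a/2 for large
      n.\<close>
    have "((\<lambda>\<epsilon>. (40 * \<epsilon>\<^sup>2 + 8 * L * \<epsilon>) / \<eta>\<^sup>2) \<longlongrightarrow> (40 * 0\<^sup>2 + 8 * L * 0) / \<eta>\<^sup>2) (at_right 0)"
      using \<eta> by (intro tendsto_intros) auto
    then have "eventually (\<lambda>\<epsilon>. (40 * \<epsilon>\<^sup>2 + 8 * L * \<epsilon>) / \<eta>\<^sup>2 < a / 2) (at_right 0)"
      using a by (intro order_tendstoD(2)) auto
    then have "eventually (\<lambda>\<epsilon>. (40 * \<epsilon>\<^sup>2 + 8 * L * \<epsilon>) / \<eta>\<^sup>2 < a / 2 \<and> 0 < \<epsilon>) (at_right 0)"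
      by (intro eventually_conj eventually_at_right_less)
    then obtain \<epsilon> where \<epsilon>: "(40 * \<epsilon>\<^sup>2 + 8 * L * \<epsilon>) / \<eta>\<^sup>2 < a / 2" "0 < \<epsilon>"
      using eventually_happens'[of "at_right (0::real)"] by (auto simp: trivial_limit_at_right_real)
    have "(\<lambda>n. 512 * C\<^sup>2 * (real n * beta_n M Z rho n (r n)) / \<eta>\<^sup>2) \<longlonglongrightarrow> 512 * C\<^sup>2 * 0 / \<eta>\<^sup>2"
      using \<eta> by (intro tendsto_intros weak_dep) auto
    then have "eventually (\<lambda>n. 512 * C\<^sup>2 * (real n * beta_n M Z rho n (r n)) / \<eta>\<^sup>2 < a / 2) sequentially"
      using a by (intro order_tendstoD(2)) auto
    with tail[OF \<epsilon>(2)]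
    show "eventually (\<lambda>n. prob {\<omega> \<in> space M. sqrt (real n) *
        \<bar>emp_dev M Z n f (A n (data_vec Z n \<omega>)) g0 \<omega>\<bar> > \<eta>} < a) sequentially"
    proof eventually_elim
      case (elim n)
      then show ?case using \<epsilon>(1) by (simp add: add_divide_distrib)
    qed
  qed
qed

end
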